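(* Let $k\ge 6$ and $g=2d\ge 6$, and let $G$ be a $(k,g)$-graph of excess $4$ with adjacency matrix $A$ and excess matrix $E$. Then: 1) The matrix $E$ is the adjacency matrix of a graph $G(E)$ consisting of a disjoint union of $c$ cycles $C_i$ of length $l_i$, $1\le i\le c$, for some $c\geq 1$. Moreover, if $d$ is odd and $V_1$ and $V_2$ are the two partition sets of the bipartite graph $G$, then every cycle of $G(E)$ is completely contained either in $V_1$ or in $V_2$. 2) The spectrum of $A$ (eigenvalues counted with multiplicity) consists of: 2.1) if $d$ is odd: $k$ and $-k$; $c-2$ many (not necessarily distinct) solutions of $H_{d-1}(x)=-2$; and one solution of each equation $H_{d-1}(x)=-2\cos\left(\frac{2\pi j}{l_i}\right)$, one for each pair $(i,j)$ with $1\le i\le c$ and $1\le j\le l_i-1$; 2.2) if $d$ is even: $k$ and $-k$; $c-1$ many (not necessarily distinct) solutions of $H_{d-1}(x)=-2$; and one solution of each equation, except one, among the equations $H_{d-1}(x)=-2\cos\left(\frac{2\pi j}{l_i}\right)$ indexed by the pairs $(i,j)$ with $1\le i\le c$ and $1\le j\le l_i-1$.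
   Context: Graphs are finite and simple. A $(k,g)$-graph is a $k$-regular graph of girth $g$. For even $g=2d$ the Moore bound is $M(k,g)=2\bigl(1+(k-1)+\dots+(k-1)^{d-1}\bigr)$, and the excess of a $(k,g)$-graph of order $n$ is $n-M(k,g)$. For $k\ge 6$ and $g=2d\ge 6$, a $(k,g)$-graph $G$ of excess $4$ is bipartite of diameter $d+1$ (known theorem of Biggs and Ito). The excess matrix $E$ of $G$ is the $n\times n$ matrix indexed by the vertices of $G$ with $E_{u,v}=1$ if the distance $d(u,v)$ in $G$ equals $d+1$, and $E_{u,v}=0$ otherwise. The excess graph $G(E)$ is the graph on the vertex set of $G$ in which two vertices are adjacent if and only if their distance in $G$ is $d+1$. The polynomials $H_i(x)$ are defined by $H_0(x)=1$, $H_1(x)=x$, and $H_{i+1}(x)=xH_i(x)-(k-1)H_{i-1}(x)$ for $i\ge 1$. *)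

theory Defs
  imports
    "Graph_Theory.Pair_Digraph"
    "Graph_Theory.Shortest_Path"
    "Jordan_Normal_Form.Char_Poly"
    "HOL-Library.Extended_Nat"
begin

text \<open>
  A finite simple graph is a \<^term>\<open>G :: 'a pair_pre_digraph\<close> with \<^term>\<open>pair_graph G\<close>: a finite
  vertex set with a symmetric, irreflexive arc relation, so that an undirected edge $uv$ is the pair of
  arcs $(u,v)$, $(v,u)$, and the degree of a vertex is its out-degree.
\<close>

definition gdist :: "'a pair_pre_digraph \<Rightarrow> 'a \<Rightarrow> 'a \<Rightarrow> ereal" where
  "gdist G u v = wf_digraph.\<mu> (with_proj G) (\<lambda>_. 1) u v"

text \<open>
  The directed notion \<^const>\<open>pre_digraph.cycle\<close> also accepts the closed walk $u, v, u$ along a single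
  edge; requiring length at least 3 leaves exactly the cycles of the undirected graph.
\<close>

definition girth :: "'a pair_pre_digraph \<Rightarrow> enat" where
  "girth G = (INF p \<in> {p. pre_digraph.cycle (with_proj G) p \<and> 3 \<le> length p}. enat (length p))"

definition kg_graph :: "nat \<Rightarrow> nat \<Rightarrow> 'a pair_pre_digraph \<Rightarrow> bool" where
  "kg_graph k g G \<longleftrightarrow>
     pair_graph G \<and> (\<forall>v\<in>pverts G. out_degree (with_proj G) v = k) \<and> girth G = enat g"

text \<open>The Moore bound $M(k, 2d)$, given as a function of $k$ and $d$.\<close>

definition moore_bound_even :: "nat \<Rightarrow> nat \<Rightarrow> nat" where
  "moore_bound_even k d = 2 * (\<Sum>i<d. (k - 1) ^ i)"

definition excess :: "nat \<Rightarrow> nat \<Rightarrow> 'a pair_pre_digraph \<Rightarrow> int" where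
  "excess k d G = int (card (pverts G)) - int (moore_bound_even k d)"

definition bipartition :: "'a pair_pre_digraph \<Rightarrow> 'a set \<Rightarrow> 'a set \<Rightarrow> bool" where
  "bipartition G V1 V2 \<longleftrightarrow>
     V1 \<union> V2 = pverts G \<and> V1 \<inter> V2 = {} \<and>
     (\<forall>(u, v) \<in> parcs G. u \<in> V1 \<and> v \<in> V2 \<or> u \<in> V2 \<and> v \<in> V1)"

text \<open>
  Matrices indexed by the vertices of a graph are taken with respect to an enumeration \<open>vs\<close> of its
  vertex set.
\<close>

definition adjacency_matrix :: "'a list \<Rightarrow> 'a pair_pre_digraph \<Rightarrow> real mat" where
  "adjacency_matrix vs G =
     mat (length vs) (length vs) (\<lambda>(i, j). if (vs ! i, vs ! j) \<in> parcs G then 1 else 0)"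

definition excess_matrix :: "nat \<Rightarrow> 'a list \<Rightarrow> 'a pair_pre_digraph \<Rightarrow> real mat" where
  "excess_matrix d vs G =
     mat (length vs) (length vs)
       (\<lambda>(i, j). if gdist G (vs ! i) (vs ! j) = ereal (real (d + 1)) then 1 else 0)"

definition excess_graph :: "nat \<Rightarrow> 'a pair_pre_digraph \<Rightarrow> 'a pair_pre_digraph" where
  "excess_graph d G =
     \<lparr> pverts = pverts G,
       parcs = {(u, v). u \<in> pverts G \<and> v \<in> pverts G \<and> gdist G u v = ereal (real (d + 1))} \<rparr>"

definition cycle_graph :: "nat \<Rightarrow> 'a pair_pre_digraph \<Rightarrow> bool" where
  "cycle_graph l C \<longleftrightarrow>
     3 \<le> l \<and>
     (\<exists>v. inj_on v {..<l} \<and> pverts C = v ` {..<l} \<and>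
          parcs C = (\<Union>i<l. {(v i, v ((i + 1) mod l)), (v ((i + 1) mod l), v i)}))"

definition disjoint_union_of ::
    "'a pair_pre_digraph \<Rightarrow> nat \<Rightarrow> (nat \<Rightarrow> 'a pair_pre_digraph) \<Rightarrow> bool" where
  "disjoint_union_of G c C \<longleftrightarrow>
     (\<forall>i<c. \<forall>j<c. i \<noteq> j \<longrightarrow> pverts (C i) \<inter> pverts (C j) = {}) \<and>
     pverts G = (\<Union>i<c. pverts (C i)) \<and>
     parcs G = (\<Union>i<c. parcs (C i))"

fun H_poly :: "nat \<Rightarrow> nat \<Rightarrow> real poly" where
  "H_poly k 0 = 1"
| "H_poly k (Suc 0) = [:0, 1:]"
| "H_poly k (Suc (Suc i)) = [:0, 1:] * H_poly k (Suc i) - [:real k - 1:] * H_poly k i"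

text \<open>
  The multiset of real eigenvalues with algebraic multiplicity. For the symmetric matrices considered
  here all eigenvalues are real and algebraic and geometric multiplicities agree.
\<close>

definition spectrum_mset :: "real mat \<Rightarrow> real multiset" where
  "spectrum_mset A = proots (char_poly A)"

end

theory Submission
  imports
    Defs
    "Jordan_Normal_Form.Schur_Decomposition"
begin

text \<open>
  For an edge \<open>w w'\<close>, all but four vertices lie in the Moore tree grown from that edge. A remaining
  vertex that had tree neighbours on both sides would force \<open>k - 1\<close> vertices outside the tree, which
  is impossible for \<open>k \<ge> 6\<close>. Hence no edge is equidistant from a vertex, the graph is bipartite
  of diameter \<open>d + 1\<close>, and, since both sides have the same size, every vertex has exactly two vertices at
  distance \<open>d + 1\<close>. So \<open>G(E)\<close> is 2-regular, that is, a disjoint union of cycles.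

  Below the girth, \<open>H\<^sub>i(A)\<close> is the indicator of the distances \<open>i, i - 2, i - 4, \<dots>\<close>; hence
  \<open>H\<^bsub>d-1\<^esub>(A) = - E + (s s\<^sup>T + \<epsilon> r r\<^sup>T) / 2\<close>, where \<open>s = 1\<close>, \<open>r = \<plusminus>1\<close> on the two sides
  and \<open>\<epsilon> = (-1)\<^bsup>d-1\<^esup>\<close>. As \<open>s\<close> and \<open>r\<close> are orthogonal common eigenvectors, the two rank one
  updates only replace the eigenvalues \<open>-2\<close> and \<open>-2 \<epsilon>\<close> of \<open>-E\<close> by \<open>H\<^bsub>d-1\<^esub>(k)\<close> and
  \<open>H\<^bsub>d-1\<^esub>(-k)\<close>, and the remaining eigenvalues of \<open>A\<close> are mapped by \<open>H\<^bsub>d-1\<^esub>\<close> onto the remaining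
  eigenvalues \<open>- 2 cos (2 \<pi> j / l\<^sub>i)\<close> of \<open>-E\<close>.
\<close>

section \<open>Graphs of even girth and excess four\<close>

text \<open>The graph is kept as a bare symmetric relation, so that walks of length \<open>m\<close>
  are the relational powers \<open>adj ^^ m\<close>. The girth enters through
  \<open>girth_le\<close>, as a lower bound on the length of vertex lists that close up to a
  cycle.\<close>

locale small_excess_graph =
  fixes V :: "'a set" and adj :: "'a \<Rightarrow> 'a \<Rightarrow> bool" and k d :: nat
  assumes finite_V: "finite V"
    and adj_V: "adj u v \<Longrightarrow> u \<in> V"
    and adj_sym: "adj u v \<Longrightarrow> adj v u"
    and adj_irrefl: "\<not> adj v v"
    and regular: "v \<in> V \<Longrightarrow> card {u. adj v u} = k"
    and girth_le: "\<lbrakk>3 \<le> length xs; distinct xs; successively adj xs; adj (last xs) (hd xs)\<rbrakk>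
                    \<Longrightarrow> 2 * d \<le> length xs"
    and card_V: "card V = moore_bound_even k d + 4"
    and k_ge: "6 \<le> k"
    and d_ge: "3 \<le> d"
begin

section \<open>Adjacency and the truncated distance\<close>

lemma adj_V2: "adj u v \<Longrightarrow> v \<in> V"
  using adj_V adj_sym by blast

lemma adj_commute: "adj u v \<longleftrightarrow> adj v u"
  using adj_sym by blast

lemma finite_nb [simp]: "finite {u. adj v u}"
  by (rule finite_subset[OF _ finite_V]) (auto dest: adj_V2)

text \<open>Truncating the distance at \<open>d + 2\<close> keeps it in \<^typ>\<open>nat\<close> before connectedness is known.\<close>

definition dst :: "'a \<Rightarrow> 'a \<Rightarrow> nat" where
  "dst u v = (LEAST m. (adj ^^ m) u v \<or> m = d + 2)"

lemma dst_cases: "(adj ^^ dst u v) u v \<or> dst u v = d + 2"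
  unfolding dst_def by (rule LeastI_ex) blast

lemma dst_walk: "dst u v \<noteq> d + 2 \<Longrightarrow> (adj ^^ dst u v) u v"
  using dst_cases by blast

lemma dst_le_walk: "(adj ^^ m) u v \<Longrightarrow> dst u v \<le> m"
  unfolding dst_def by (rule Least_le) blast

lemma dst_le: "dst u v \<le> d + 2"
  unfolding dst_def by (rule Least_le) blast

lemma walk_sym: "(adj ^^ m) u v \<longleftrightarrow> (adj ^^ m) v u"
proof (induction m arbitrary: u v)
  case (Suc m)
  have "(adj ^^ Suc m) v u" if uv: "(adj ^^ Suc m) u v" for u v
  proof -
    obtain x where "adj u x" "(adj ^^ m) x v" using relpowp_Suc_E2[OF uv] .
    then have "(adj ^^ m) v x" "adj x u" using Suc.IH adj_sym by blast+
    then show ?thesis by (rule relpowp_Suc_I)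
  qed
  then show ?case by blast
qed auto

lemma dst_sym: "dst u v = dst v u"
  unfolding dst_def by (subst walk_sym) simp

lemma dst_self [simp]: "dst u u = 0"
  using dst_le_walk[of 0 u u] by simp

lemma dst_eq_0: "dst u v = 0 \<longleftrightarrow> u = v"
  using dst_walk[of u v] by auto

lemma dst_lipschitz: "adj x y \<Longrightarrow> dst w y \<le> dst w x + 1"
proof (cases "dst w x = d + 2")
  case True
  then show ?thesis using dst_le[of w y] by simp
next
  case False
  assume "adj x y"
  with dst_walk[OF False] have "(adj ^^ Suc (dst w x)) w y" by auto
  then show ?thesis using dst_le_walk by fastforce
qed

lemma dst_nb:
  assumes "adj x y"
  shows "dst w y = dst w x \<or> dst w y = dst w x + 1 \<or> dst w x = dst w y + 1"
  using dst_lipschitz[OF assms, of w] dst_lipschitz[OF adj_sym[OF assms], of w] by linarith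

lemma dst_eq_1: "dst u v = Suc 0 \<longleftrightarrow> adj u v"
proof
  assume "dst u v = Suc 0"
  then show "adj u v" using dst_walk[of u v] by auto
next
  assume *: "adj u v"
  then have "dst u v \<noteq> 0" using adj_irrefl dst_eq_0 by metis
  moreover have "dst u v \<le> 1" using dst_le_walk[of "Suc 0" u v] * by (simp del: relpowp.simps add: relpowp_1)
  ultimately show "dst u v = Suc 0" by simp
qed

section \<open>Levels around a vertex and short cycles\<close>

lemma parent_ex:
  assumes "dst w x = Suc m" "dst w x < d + 2"
  obtains y where "adj x y" "dst w y = m"
proof -
  have "(adj ^^ Suc m) w x" using dst_walk[of w x] assms by simp
  then obtain y where y: "(adj ^^ m) w y" "adj y x" by auto
  have "dst w y \<le> m" using y dst_le_walk by blast
  moreover have "Suc m \<le> dst w y + 1" using dst_lipschitz[OF y(2), of w] assms by simp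
  ultimately show ?thesis using that y adj_sym by auto
qed

text \<open>Descend from \<open>p\<close> and \<open>q\<close> by parents until the two descents
  meet, at \<open>w\<close> at the latest. The bound on the levels makes the two end points added in
  each induction step fresh, so the path stays simple.\<close>

lemma level_path:
  assumes "p \<noteq> q" "dst w p = i" "dst w q = i" "i < d + 2"
  shows "\<exists>xs. distinct xs \<and> hd xs = p \<and> last xs = q \<and> successively adj xs \<and>
           3 \<le> length xs \<and> length xs \<le> 2 * i + 1 \<and> (\<forall>x\<in>set xs. dst w x \<le> i)"
  using assms
proof (induction i arbitrary: p q)
  case 0
  then show ?case by (metis dst_eq_0)
next
  case (Suc i)
  obtain p' where p': "adj p p'" "dst w p' = i" using parent_ex[of w p i] Suc.prems by auto
  obtain q' where q': "adj q q'" "dst w q' = i" using parent_ex[of w q i] Suc.prems by auto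
  show ?case
  proof (cases "p' = q'")
    case True
    have "p \<noteq> p'" "q \<noteq> p'" using adj_irrefl p' q' True by auto
    then show ?thesis using p' q' True Suc.prems adj_sym[OF q'(1)]
      by (intro exI[of _ "[p, p', q]"]) auto
  next
    case False
    with Suc p' q' obtain xs where xs: "distinct xs" "hd xs = p'" "last xs = q'"
      "successively adj xs" "3 \<le> length xs" "length xs \<le> 2 * i + 1" "\<forall>x\<in>set xs. dst w x \<le> i"
      by (metis Suc_lessD)
    have "xs \<noteq> []" using xs by auto
    have "p \<notin> set xs" "q \<notin> set xs" using xs Suc.prems by auto
    then show ?thesis using xs p' q' Suc.prems adj_sym[OF q'(1)] \<open>xs \<noteq> []\<close>
      by (intro exI[of _ "p # xs @ [q]"])
         (auto simp: successively_append_iff successively_Cons)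
  qed
qed

text \<open>The edge \<open>u v\<close> closes the path of \<open>level_path\<close> to a cycle of
  at most \<open>2 i + 1\<close> vertices, where \<open>i\<close> is the common level; this is less
  than \<open>2 d\<close> when \<open>i < d\<close>.\<close>

lemma same_level_ge:
  assumes "adj u v" "dst w u = dst w v"
  shows "d \<le> dst w u"
proof (rule ccontr)
  assume *: "\<not> ?thesis"
  have "u \<noteq> v" using assms adj_irrefl by auto
  moreover have "dst w u < d + 2" using * by simp
  ultimately obtain xs where xs: "distinct xs" "hd xs = u" "last xs = v" "successively adj xs"
    "3 \<le> length xs" "length xs \<le> 2 * dst w u + 1"
    using level_path[OF _ refl assms(2)[symmetric]] by blast
  show False using girth_le[of xs] xs assms adj_sym * by auto
qed

text \<open>Two parents of \<open>y\<close> are joined by the path of \<open>level_path\<close>;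
  with \<open>y\<close> it forms a cycle of at most \<open>2 i + 2\<close> vertices. Hence parents
  are unique below level \<open>d\<close>.\<close>

lemma two_parents_ge:
  assumes "adj y p" "adj y q" "p \<noteq> q" "dst w p = i" "dst w q = i" "dst w y = Suc i"
  shows "d \<le> Suc i"
proof (rule ccontr)
  assume *: "\<not> ?thesis"
  have "i < d + 2" using * by simp
  from level_path[OF assms(3-5) this]
  obtain xs where xs: "distinct xs" "hd xs = p" "last xs = q" "successively adj xs"
    "3 \<le> length xs" "length xs \<le> 2 * i + 1" "\<forall>x\<in>set xs. dst w x \<le> i" by blast
  have "xs \<noteq> []" "y \<notin> set xs" using xs assms(6) by auto
  then show False using girth_le[of "y # xs"] xs assms adj_sym * by (auto simp: successively_Cons)
qed

lemma parents_singleton: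
  assumes "dst w y = Suc i" "Suc i < d"
  obtains p where "{x. adj y x \<and> dst w x = i} = {p}"
proof -
  obtain p where "adj y p" "dst w p = i" using parent_ex[of w y i] assms by auto
  then have "{x. adj y x \<and> dst w x = i} = {p}" using two_parents_ge assms by fastforce
  then show ?thesis by (rule that)
qed

lemma no_triangle: "adj u v \<Longrightarrow> adj v w \<Longrightarrow> \<not> adj u w"
proof
  assume *: "adj u v" "adj v w" "adj u w"
  then have "dst u v = Suc 0" "dst u w = Suc 0" by (simp_all only: dst_eq_1)
  then show False using same_level_ge[of v w u] * d_ge by simp
qed

lemma no_quadrangle:
  assumes "adj u x" "adj v x" "adj u y" "adj v y" "u \<noteq> v"
  shows "x = y"
proof (rule ccontr)
  assume ne: "x \<noteq> y"
  have 1: "dst u x = Suc 0" "dst u y = Suc 0" using assms dst_eq_1 by auto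
  have "dst u v \<noteq> 0" "dst u v \<noteq> Suc 0"
    using assms dst_eq_0 dst_eq_1 no_triangle[of u x v] adj_sym by metis+
  moreover have "dst u v \<le> 2" using dst_lipschitz[of x v u] 1 assms adj_sym by auto
  ultimately have "dst u v = Suc (Suc 0)" by linarith
  then show False using two_parents_ge[of v x y u "Suc 0"] assms ne 1 d_ge by auto
qed

section \<open>Distance indicators and their row sums\<close>

definition ball_ind :: "nat \<Rightarrow> 'a \<Rightarrow> 'a \<Rightarrow> real" where
  "ball_ind i u v = (if dst u v \<le> i \<and> even (dst u v + i) then 1 else 0)"

lemma ball_ind_0: "ball_ind 0 u v = (if u = v then 1 else 0)"
  by (auto simp: ball_ind_def dst_eq_0)

lemma ball_ind_1: "ball_ind (Suc 0) u v = (if adj u v then 1 else 0)"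
  using dst_eq_1[of u v] by (auto simp: ball_ind_def le_Suc_eq dst_eq_0 dest: odd_pos)

text \<open>This is the recurrence of the polynomials \<open>H_i\<close>, read entrywise. According
  to the level \<open>m\<close> of \<open>v\<close>, the sum counts all
  \<open>k = 1 + (k - 1)\<close> neighbours if \<open>m \<le> i - 1\<close>, only the unique parent
  if \<open>m = i + 1\<close>, and none if \<open>m\<close> is larger or has the wrong
  parity.\<close>

lemma ball_ind_rec:
  assumes v: "v \<in> V" and i: "1 \<le> i" "i + 2 \<le> d"
  shows "(\<Sum>y\<in>{y. adj v y}. ball_ind i w y) =
           ball_ind (i + 1) w v + (real k - 1) * ball_ind (i - 1) w v"
proof -
  define m where "m = dst w v"
  define Q where "Q = {y. adj v y \<and> dst w y \<le> i \<and> even (dst w y + i)}"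
  have nb: "dst w y = m + 1 \<or> m = dst w y + 1 \<or> (dst w y = m \<and> d \<le> m)" if "adj v y" for y
    using dst_nb[OF that, of w] same_level_ge[OF that, of w] m_def by auto
  have "(\<Sum>y\<in>{y. adj v y}. ball_ind i w y) = real (card Q)"
    unfolding ball_ind_def Q_def by (simp flip: sum.inter_filter)
  also have "\<dots> = ball_ind (i + 1) w v + (real k - 1) * ball_ind (i - 1) w v"
  proof (cases "even (m + i)")
    case True
    then have "Q = {}" unfolding Q_def using i by (auto dest!: nb)
    then show ?thesis using True i by (auto simp: ball_ind_def m_def)
  next
    case odd: False
    consider "m \<le> i - 1" | "m = Suc i" | "m > Suc i"
    proof -
      have "m \<noteq> i" using odd by auto
      then show thesis using that i by linarith
    qed
    then show ?thesis
    proof cases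
      case 1
      have "dst w y \<le> i \<and> even (dst w y + i)" if "adj v y" for y
        using nb[OF that] 1 odd i by (elim disjE) auto
      then have "Q = {y. adj v y}" unfolding Q_def by blast
      then have "card Q = k" using regular v by simp
      then show ?thesis using 1 odd i by (auto simp: ball_ind_def m_def)
    next
      case 2
      obtain p where p: "{x. adj v x \<and> dst w x = i} = {p}"
        using parents_singleton[of w v i] 2 i m_def by auto
      have "(dst w y \<le> i \<and> even (dst w y + i)) = (dst w y = i)" if "adj v y" for y
        using nb[OF that] 2 i by (elim disjE) auto
      then have "Q = {x. adj v x \<and> dst w x = i}" unfolding Q_def by blast
      then have "card Q = 1" using p by simp
      then show ?thesis using 2 i by (auto simp: ball_ind_def m_def)
    next
      case 3
      then have "Q = {}" unfolding Q_def using i by (auto dest!: nb)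
      then show ?thesis using 3 i by (auto simp: ball_ind_def m_def)
    qed
  qed
  finally show ?thesis .
qed

lemma sum_nb_swap:
  fixes f :: "'a \<Rightarrow> real"
  shows "(\<Sum>v\<in>V. \<Sum>y\<in>{y. adj v y}. f y) = real k * (\<Sum>y\<in>V. f y)"
proof -
  have "(\<Sum>v\<in>V. \<Sum>y\<in>{y. adj v y}. f y) = (\<Sum>v\<in>V. \<Sum>y\<in>{y\<in>V. adj v y}. f y)"
    by (intro sum.cong refl) (auto dest: adj_V2)
  also have "\<dots> = (\<Sum>y\<in>V. \<Sum>v\<in>{v\<in>V. adj v y}. f y)"
    by (rule sum.swap_restrict) (auto simp: finite_V)
  also have "\<dots> = (\<Sum>y\<in>V. real k * f y)"
  proof (intro sum.cong refl)
    fix y assume "y \<in> V"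
    have "{v \<in> V. adj v y} = {v. adj y v}" by (auto dest: adj_sym adj_V2)
    then show "(\<Sum>v\<in>{v\<in>V. adj v y}. f y) = real k * f y" using regular \<open>y \<in> V\<close> by simp
  qed
  finally show ?thesis by (simp add: sum_distrib_left)
qed

text \<open>Summed over \<open>v\<close>, \<open>ball_ind_rec\<close> becomes a linear recurrence
  for the row sums with coefficients \<open>k\<close> and \<open>-(k - 1)\<close>, which the partial
  geometric sums satisfy.\<close>

lemma sum_ball_ind:
  assumes "w \<in> V" "i < d"
  shows "(\<Sum>v\<in>V. ball_ind i w v) = (\<Sum>j<Suc i. (real k - 1) ^ j)"
  using assms(2)
proof (induction i rule: induct_nat_012)
  case 0
  then show ?case using assms finite_V by (simp add: ball_ind_0)
next
  case 1
  have "V \<inter> {v. adj w v} = {v. adj w v}" using adj_V2 by blast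
  then have "(\<Sum>v\<in>V. ball_ind (Suc 0) w v) = real k"
    using assms finite_V regular[of w] by (simp add: ball_ind_1 sum.If_cases)
  then show ?case by simp
next
  case (ge2 i)
  have "(\<Sum>v\<in>V. \<Sum>y\<in>{y. adj v y}. ball_ind (Suc i) w y) =
        (\<Sum>v\<in>V. ball_ind (Suc (Suc i)) w v + (real k - 1) * ball_ind i w v)"
    using ge2.prems by (intro sum.cong refl) (subst ball_ind_rec, auto)
  then have "real k * (\<Sum>y\<in>V. ball_ind (Suc i) w y) =
        (\<Sum>v\<in>V. ball_ind (Suc (Suc i)) w v) + (real k - 1) * (\<Sum>v\<in>V. ball_ind i w v)"
    by (simp add: sum_nb_swap sum.distrib sum_distrib_left)
  then show ?case using ge2 by (simp add: algebra_simps)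
qed

definition half_moore :: nat where "half_moore = (\<Sum>i<d. (k - 1) ^ i)"

text \<open>The levels \<open>d - 1\<close>, \<open>d - 3\<close>, ... are the support of
  \<open>ball_ind (d - 1)\<close>, so the count is its row sum.\<close>

lemma card_parity_ball:
  assumes "w \<in> V"
  shows "card {x\<in>V. dst w x < d \<and> odd (dst w x + d)} = half_moore"
proof -
  have "real (card {x\<in>V. dst w x < d \<and> odd (dst w x + d)}) = (\<Sum>x\<in>V. ball_ind (d - 1) w x)"
    unfolding ball_ind_def using finite_V d_ge
    by (simp flip: sum.inter_filter) (intro arg_cong[where f = card], auto)
  also have "\<dots> = (\<Sum>j<d. (real k - 1) ^ j)"
    using sum_ball_ind[OF assms, of "d - 1"] d_ge by simp
  also have "\<dots> = real half_moore" unfolding half_moore_def using k_ge by (simp add: of_nat_diff)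
  finally show ?thesis by linarith
qed

section \<open>Vertices outside the Moore tree of an edge\<close>

definition outer :: "'a \<Rightarrow> 'a \<Rightarrow> 'a set" where
  "outer u v = {x\<in>V. d \<le> dst u x \<and> d \<le> dst v x}"

lemma finite_outer [simp]: "finite (outer u v)"
  unfolding outer_def using finite_V by simp

lemma dst_ends:
  assumes "adj u v"
  shows "dst u x = dst v x + 1 \<or> dst v x = dst u x + 1 \<or> (dst u x = dst v x \<and> d \<le> dst u x)"
  using dst_nb[OF assms, of x] same_level_ge[OF assms, of x] dst_sym[of _ x] by auto

text \<open>A vertex of the tree has distances to \<open>u\<close> and \<open>v\<close> that differ
  by one, so exactly one of them has the parity of \<open>d - 1\<close>, and that one is below
  \<open>d\<close>. Thus \<open>?P u\<close> and \<open>?P v\<close> partition the tree into two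
  sets of size \<open>half_moore\<close>, and the excess is what remains.\<close>

lemma card_outer:
  assumes "adj u v"
  shows "card (outer u v) = 4"
proof -
  let ?P = "\<lambda>w. {x\<in>V. dst w x < d \<and> odd (dst w x + d)}"
  have uv: "u \<in> V" "v \<in> V" using assms adj_V adj_V2 by auto
  have eq: "V = outer u v \<union> (?P u \<union> ?P v)"
  proof (intro equalityI subsetI)
    fix x assume x: "x \<in> V"
    show "x \<in> outer u v \<union> (?P u \<union> ?P v)"
    proof (cases "x \<in> outer u v")
      case False
      then have lt: "dst u x < d \<or> dst v x < d" using x by (auto simp: outer_def)
      show ?thesis
      proof (cases "odd (dst u x + d)")
        case True
        then have "dst u x \<noteq> d" by auto
        then have "dst u x < d" using dst_ends[OF assms, of x] lt by linarith
        then show ?thesis using True x by auto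
      next
        case e: False
        then have o: "odd (dst v x + d)" using dst_ends[OF assms, of x] lt by auto
        then have "dst v x \<noteq> d" by auto
        then have "dst v x < d" using dst_ends[OF assms, of x] lt by linarith
        then show ?thesis using o x by auto
      qed
    qed auto
  qed (auto simp: outer_def)
  have "?P u \<inter> ?P v = {}"
  proof (rule ccontr)
    assume "?P u \<inter> ?P v \<noteq> {}"
    then obtain x where "dst u x < d" "odd (dst u x + d)" "odd (dst v x + d)" by auto
    then show False using dst_ends[OF assms, of x] by auto
  qed
  then have "card (?P u \<union> ?P v) = 2 * half_moore"
    using card_parity_ball uv finite_V by (subst card_Un_disjoint) auto
  moreover have "card V = card (outer u v) + card (?P u \<union> ?P v)"
    by (subst eq, rule card_Un_disjoint) (auto simp: finite_V outer_def)
  ultimately show ?thesis using card_V by (simp add: moore_bound_even_def half_moore_def)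
qed

text \<open>
  A neighbour \<open>z\<close> of \<open>y\<close> at distance \<open>d - 1\<close> from \<open>w\<close> determines the first vertex after \<open>w\<close> of its
  geodesic to \<open>w\<close>; these first vertices are distinct, also for two adjacent \<open>y\<close>, \<open>v\<close> at distance \<open>d\<close>.
\<close>
lemma geodesics_add_le:
  assumes "w \<in> V" "adj y v" "dst w y = d" "dst w v = d"
  shows "card {z. adj y z \<and> dst w z = d - 1} + card {z. adj v z \<and> dst w z = d - 1} \<le> k"
proof -
  define W where "W y = {x. adj w x \<and> dst y x = d - 1}" for y
  have inj: "card {z. adj y z \<and> dst w z = d - 1} \<le> card (W y)" if y: "dst w y = d" for y
  proof -
    let ?Z = "{z. adj y z \<and> dst w z = d - 1}"
    have "\<forall>z\<in>?Z. \<exists>x. adj w x \<and> dst z x = d - 2"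
    proof
      fix z assume z: "z \<in> ?Z"
      then have "dst z w = Suc (d - 2)" using d_ge dst_sym[of z w] by simp
      then show "\<exists>x. adj w x \<and> dst z x = d - 2" by (rule parent_ex) (use z d_ge dst_sym in auto)
    qed
    then obtain f where f: "\<And>z. z \<in> ?Z \<Longrightarrow> adj w (f z) \<and> dst z (f z) = d - 2" by metis
    have fy: "dst y (f z) = d - 1" if "z \<in> ?Z" for z
    proof -
      have "dst (f z) y \<le> dst (f z) z + 1" using that dst_lipschitz[of z y "f z"] adj_sym by auto
      moreover have "dst y w \<le> dst y (f z) + 1" using f[OF that] dst_lipschitz[of "f z" w y] adj_sym by auto
      ultimately show ?thesis using f[OF that] y d_ge by (simp add: dst_sym)
    qed
    \<comment> \<open>Two neighbours of \<open>y\<close> with the same first vertex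
      \<open>f z\<close> would be two parents of \<open>y\<close> in the levels around
      \<open>f z\<close>, where \<open>y\<close> has level \<open>d - 1 < d\<close>.\<close>
    have "inj_on f ?Z"
    proof (rule inj_onI, rule ccontr)
      fix z z' assume zz: "z \<in> ?Z" "z' \<in> ?Z" "f z = f z'" "z \<noteq> z'"
      have "d \<le> Suc (d - 2)"
        using zz f[of z] f[of z'] fy[of z] d_ge dst_sym
        by (intro two_parents_ge[of y z z' "f z" "d - 2"]) auto
      then show False using d_ge by simp
    qed
    moreover have "f ` ?Z \<subseteq> W y" using f fy by (auto simp: W_def)
    ultimately show ?thesis by (rule card_inj_on_le) (simp add: W_def)
  qed
  \<comment> \<open>A common first vertex would be equidistant, at distance \<open>d - 1\<close>,
    from the ends of the edge \<open>y v\<close>.\<close>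
  have "W y \<inter> W v = {}"
  proof (rule ccontr)
    assume "W y \<inter> W v \<noteq> {}"
    then obtain x where "dst x y = d - 1" "dst x v = d - 1" unfolding W_def using dst_sym by auto
    then show False using same_level_ge[OF assms(2), of x] d_ge by simp
  qed
  then have "card (W y) + card (W v) = card (W y \<union> W v)"
    by (intro card_Un_disjoint[symmetric]) (auto simp: W_def)
  also have "\<dots> \<le> card {x. adj w x}" by (rule card_mono) (auto simp: W_def)
  also have "\<dots> = k" using regular assms by simp
  finally show ?thesis using inj[OF assms(3)] inj[OF assms(4)] by simp
qed

text \<open>
  Counting the vertices of \<^term>\<open>outer w w'\<close> within distance two of \<open>v\<close>: with \<open>a\<close> and \<open>b\<close>
  neighbours of \<open>v\<close> on the two sides there are at least
  \<open>1 + (k - a - b) + b (a - 1) + a (b - 1) = k - 1 + 2 (a - 1) (b - 1)\<close> of them.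
\<close>
lemma outer_one_side:
  assumes ww: "adj w w'" and v: "v \<in> outer w w'"
    and p: "adj v p" "dst w p = d - 1" and q: "adj v q" "dst w' q = d - 1"
  shows False
proof -
  let ?X = "outer w w'"
  define P where "P = {y. adj v y \<and> dst w y = d - 1}"
  define Q where "Q = {y. adj v y \<and> dst w' y = d - 1}"
  define R where "R = {y. adj v y \<and> y \<in> ?X}"
  have V: "w \<in> V" "w' \<in> V" "v \<in> V" using ww adj_V adj_V2 v by (auto simp: outer_def)
  have vd: "d \<le> dst w v" "d \<le> dst w' v" using v by (auto simp: outer_def)
  have fin [simp]: "finite P" "finite Q" "finite R" by (auto simp: P_def Q_def R_def)
  have nb: "{y. adj v y} = P \<union> Q \<union> R"
  proof -
    have "y \<in> P \<union> Q \<union> R" if "adj v y" for y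
      using dst_nb[OF that, of w] dst_nb[OF that, of w'] vd that adj_V2[OF that]
      by (auto simp: P_def Q_def R_def outer_def)
    then show ?thesis by (auto simp: P_def Q_def R_def)
  qed
  have PQ: "P \<inter> Q = {}" 
  proof (rule ccontr)
    assume "P \<inter> Q \<noteq> {}"
    then obtain x where "dst w x = d - 1" "dst w' x = d - 1" by (auto simp: P_def Q_def)
    then show False using dst_ends[OF ww, of x] d_ge by linarith
  qed
  have "P \<inter> R = {}" "Q \<inter> R = {}" using d_ge by (auto simp: P_def Q_def R_def outer_def)
  then have k_eq: "k = card P + card Q + card R"
    using regular[OF V(3)] PQ by (simp add: nb card_Un_disjoint Int_Un_distrib2)
  have ne: "1 \<le> card P" "1 \<le> card Q" using p q by (auto simp: P_def Q_def Suc_le_eq card_gt_0_iff)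
  have dv: "dst w v = d" "dst w' v = d"
    using dst_nb[OF p(1), of w] dst_nb[OF q(1), of w'] p q vd d_ge by auto
  \<comment> \<open>\<open>U y\<close> collects the outer vertices that the neighbour
    \<open>y\<close> of \<open>v\<close> contributes: \<open>y\<close> itself if it is outer,
    otherwise the outer neighbours of \<open>y\<close> other than \<open>v\<close>.\<close>
  define U where "U y = (if y \<in> R then {y} else {z. adj y z \<and> z \<in> ?X} - {v})" for y
  \<comment> \<open>The vertex \<open>y\<close> lies at distance \<open>d\<close> from
    \<open>u\<close>, and each of its neighbours is at distance \<open>d - 1\<close> from
    \<open>u\<close> or outer. By \<open>geodesics_add_le\<close> for the edge \<open>y v\<close>,
    the former number at most \<open>k\<close> minus the count for \<open>v\<close>, so the outer
    ones are at least as many as the count for \<open>v\<close>; one of them is \<open>v\<close>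
    itself.\<close>
  have side: "card {y. adj v y \<and> dst u y = d - 1} - 1 \<le> card ({z. adj y z \<and> z \<in> outer u u'} - {v})"
    if "adj u u'" "adj v y" "dst u' y = d - 1" "dst u v = d" "dst u' v = d" for u u' y
  proof -
    have uV: "u \<in> V" using that adj_V by auto
    have "dst u y = d"
      using dst_ends[OF that(1), of y] dst_nb[OF that(2), of u] that d_ge by auto
    have sub: "{z. adj y z} \<subseteq> {z. adj y z \<and> dst u z = d - 1} \<union> {z. adj y z \<and> z \<in> outer u u'}"
    proof
      fix z assume "z \<in> {z. adj y z}"
      then have z: "adj y z" by simp
      have "d - 1 \<le> dst u z" using dst_nb[OF z, of u] \<open>dst u y = d\<close> by linarith
      moreover have "dst u' z \<noteq> d - 1" using same_level_ge[OF z, of u'] that d_ge by linarith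
      moreover have "d - 2 \<le> dst u' z" using dst_nb[OF z, of u'] that(3) by linarith
      ultimately have "d - 1 \<le> dst u z" "d - 2 \<le> dst u' z" "dst u' z \<noteq> d - 1" by blast+
      then show "z \<in> {z. adj y z \<and> dst u z = d - 1} \<union> {z. adj y z \<and> z \<in> outer u u'}"
        using z dst_ends[OF that(1), of z] adj_V2[OF z] by (auto simp: outer_def)
    qed
    have "k = card {z. adj y z}" using regular adj_V2[OF that(2)] by simp
    also have "\<dots> \<le> card {z. adj y z \<and> dst u z = d - 1} + card {z. adj y z \<and> z \<in> outer u u'}"
      by (rule order_trans[OF card_mono[OF _ sub] card_Un_le]) simp
    finally have "k \<le> card {z. adj y z \<and> dst u z = d - 1} + card {z. adj y z \<and> z \<in> outer u u'}" .
    moreover have "card {z. adj y z \<and> dst u z = d - 1} + card {z. adj v z \<and> dst u z = d - 1} \<le> k"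
      using geodesics_add_le[OF uV adj_sym[OF that(2)]] \<open>dst u y = d\<close> that by simp
    moreover have "card {z. adj y z \<and> z \<in> outer u u'} - 1 \<le> card ({z. adj y z \<and> z \<in> outer u u'} - {v})"
      by (simp add: card_Diff_singleton_if)
    ultimately show ?thesis by linarith
  qed
  have UQ: "card P - 1 \<le> card (U y)" if "y \<in> Q" for y
    using side[OF ww, of y] that dv \<open>Q \<inter> R = {}\<close> by (auto simp: U_def P_def Q_def)
  have UP: "card Q - 1 \<le> card (U y)" if "y \<in> P" for y
    using side[OF adj_sym[OF ww], of y] that dv \<open>P \<inter> R = {}\<close>
    by (auto simp: U_def P_def Q_def outer_def conj_commute)
  have finU [simp]: "finite (U y)" for y
    unfolding U_def by simp
  \<comment> \<open>A vertex in two of these sets would close a triangle or a quadrangle through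
    \<open>v\<close>.\<close>
  have disj: "U y \<inter> U y' = {}" if "adj v y" "adj v y'" "y \<noteq> y'" for y y'
  proof (rule ccontr)
    assume "U y \<inter> U y' \<noteq> {}"
    then obtain z where z: "z \<in> U y" "z \<in> U y'" by auto
    have "(z = y \<or> adj y z \<and> z \<noteq> v)" "(z = y' \<or> adj y' z \<and> z \<noteq> v)"
      using z unfolding U_def by (auto split: if_splits)
    then show False
      using that no_triangle[of v y y'] no_triangle[of v y' y] no_quadrangle[of y v y' z] adj_sym
      by metis
  qed
  have "(\<Union>y\<in>{y. adj v y}. U y) \<subseteq> ?X - {v}"
    using adj_irrefl by (auto simp: U_def R_def split: if_splits)
  then have "card (\<Union>y\<in>{y. adj v y}. U y) \<le> card (?X - {v})" by (rule card_mono[rotated]) simp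
  also have "\<dots> = 3" using card_outer[OF ww] v by (simp add: card_Diff_singleton)
  finally have "(\<Sum>y\<in>{y. adj v y}. card (U y)) \<le> 3"
    using disj by (subst (asm) card_UN_disjoint) auto
  moreover have "(\<Sum>y\<in>{y. adj v y}. card (U y)) =
      (\<Sum>y\<in>P. card (U y)) + (\<Sum>y\<in>Q. card (U y)) + (\<Sum>y\<in>R. card (U y))"
    unfolding nb using PQ \<open>P \<inter> R = {}\<close> \<open>Q \<inter> R = {}\<close>
    by (simp add: sum.union_disjoint Int_Un_distrib2)
  moreover have "card P * (card Q - 1) \<le> (\<Sum>y\<in>P. card (U y))"
    using sum_bounded_below[of P "card Q - 1" "\<lambda>y. card (U y)"] UP by simp
  moreover have "card Q * (card P - 1) \<le> (\<Sum>y\<in>Q. card (U y))"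
    using sum_bounded_below[of Q "card P - 1" "\<lambda>y. card (U y)"] UQ by simp
  moreover have "(\<Sum>y\<in>R. card (U y)) = card R" by (simp add: U_def)
  ultimately have le: "card P * (card Q - 1) + card Q * (card P - 1) + card R \<le> 3" by linarith
  obtain a where a: "card P = Suc a" using ne by (metis Suc_le_D One_nat_def)
  obtain b where b: "card Q = Suc b" using ne by (metis Suc_le_D One_nat_def)
  \<comment> \<open>With \<open>a = card P - 1\<close> and \<open>b = card Q - 1\<close> the bound
    reads \<open>2 a b + a + b + card R \<le> 3\<close>, while
    \<open>a + b + card R = k - 2 \<ge> 4\<close>.\<close>
  show False using le k_eq k_ge a b by (simp add: algebra_simps)
qed

section \<open>Diameter and bipartiteness\<close>

lemma nb_ex:
  assumes "w \<in> V"
  obtains w' where "adj w w'"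
proof -
  have "card {u. adj w u} \<noteq> 0" using regular[OF assms] k_ge by simp
  then have "{u. adj w u} \<noteq> {}" by (metis card.empty)
  then show ?thesis using that by blast
qed

text \<open>Only four vertices are outer but \<open>x\<close> has at least six neighbours, so one of
  them is in the tree; being adjacent to an outer vertex, it lies in the last level of the
  tree.\<close>

lemma outer_nb:
  assumes "adj u v" "x \<in> outer u v"
  obtains y where "adj x y" "dst u y = d - 1 \<or> dst v y = d - 1"
proof -
  have xV: "x \<in> V" using assms by (simp add: outer_def)
  have "\<not> {y. adj x y} \<subseteq> outer u v"
  proof
    assume "{y. adj x y} \<subseteq> outer u v"
    then have "card {y. adj x y} \<le> card (outer u v)" by (intro card_mono) auto
    then show False using regular[OF xV] card_outer[OF assms(1)] k_ge by simp
  qed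
  then obtain y where y: "adj x y" "y \<notin> outer u v" by blast
  have "dst u y = d - 1 \<or> dst v y = d - 1"
    using y adj_V2[OF y(1)] assms(2) dst_nb[OF y(1), of u] dst_nb[OF y(1), of v]
    by (auto simp: outer_def)
  then show ?thesis using that y by blast
qed

text \<open>An outer vertex is within \<open>d\<close> of one end of the edge by
  \<open>outer_nb\<close>, hence within \<open>d + 1\<close> of the other end. Since the truncation
  value \<open>d + 2\<close> is never reached, \<open>dst\<close> is from here on the true distance
  on \<open>V\<close>.\<close>

lemma diameter_le:
  assumes "w \<in> V" "x \<in> V"
  shows "dst w x \<le> d + 1"
proof -
  obtain w' where w': "adj w w'" using nb_ex assms by blast
  show ?thesis
  proof (cases "x \<in> outer w w'")
    case True
    then obtain y where y: "adj x y" "dst w y = d - 1 \<or> dst w' y = d - 1"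
      using outer_nb[OF w'] by metis
    then show ?thesis
      using dst_nb[OF y(1), of w] dst_nb[OF y(1), of w'] dst_ends[OF w', of x] d_ge by auto
  next
    case False
    then show ?thesis using assms dst_ends[OF w', of x] by (auto simp: outer_def)
  qed
qed

text \<open>If \<open>w\<close> were equidistant from \<open>u\<close> and \<open>v\<close>, it
  would be outer for the edge \<open>u v\<close>. The neighbour from \<open>outer_nb\<close> forces
  both distances to be \<open>d\<close>, so \<open>w\<close> has a parent toward each end, which
  \<open>outer_one_side\<close> excludes. This is bipartiteness.\<close>

lemma dst_nb_ne:
  assumes "w \<in> V" "adj u v"
  shows "dst w u \<noteq> dst w v"
proof
  assume eq: "dst w u = dst w v"
  then have ge: "d \<le> dst w u" using same_level_ge[OF assms(2)] by blast
  then have out: "w \<in> outer u v" using assms eq dst_sym[of _ w] by (auto simp: outer_def)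
  then obtain y where y: "adj w y" "dst u y = d - 1 \<or> dst v y = d - 1"
    using outer_nb[OF assms(2)] by metis
  have "dst w u = d"
    using y(2) dst_nb[OF y(1), of u] dst_nb[OF y(1), of v] ge eq d_ge by (auto simp: dst_sym)
  then have eqs: "dst u w = Suc (d - 1)" "dst v w = Suc (d - 1)"
    using eq d_ge by (auto simp: dst_sym)
  obtain p where "adj w p" "dst u p = d - 1" using parent_ex[OF eqs(1)] eqs d_ge by auto
  moreover obtain q where "adj w q" "dst v q = d - 1" using parent_ex[OF eqs(2)] eqs d_ge by auto
  ultimately show False using outer_one_side[OF assms(2) out] by blast
qed

lemma walk_parity:
  assumes "w \<in> V" "(adj ^^ m) u v"
  shows "even (dst w u + dst w v) \<longleftrightarrow> even m"
  using assms(2)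
proof (induction m arbitrary: v)
  case (Suc m)
  then obtain x where x: "(adj ^^ m) u x" "adj x v" by auto
  have "even (dst w x + dst w v) = False"
    using dst_nb[OF x(2), of w] dst_nb_ne[OF assms(1) x(2)] by auto
  then show ?case using Suc.IH[OF x(1)] by (simp; presburger)
qed auto

lemma dst_walk_V:
  assumes "u \<in> V" "v \<in> V"
  shows "(adj ^^ dst u v) u v"
  using dst_walk diameter_le[OF assms] by simp

lemma dst_parity:
  assumes "w \<in> V" "u \<in> V" "v \<in> V"
  shows "even (dst w u + dst w v) \<longleftrightarrow> even (dst u v)"
  using walk_parity[OF assms(1) dst_walk_V[OF assms(2,3)]] .

section \<open>Sizes of the two sides and the number of antipodes\<close>

lemma card_sides_eq:
  assumes "w \<in> V"
  shows "card {x\<in>V. even (dst w x)} = card {x\<in>V. odd (dst w x)}"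
proof -
  let ?f = "\<lambda>y. if even (dst w y) then 1 else 0 :: real"
  let ?g = "\<lambda>y. if odd (dst w y) then 1 else 0 :: real"
  \<comment> \<open>Summing \<open>?f\<close> over all neighbourhoods gives \<open>k\<close> for
    each odd vertex; by \<open>sum_nb_swap\<close> it also gives \<open>k\<close> for each even
    one.\<close>
  have nb: "(\<Sum>y\<in>{y. adj v y}. ?f y) = real k * ?g v" if "v \<in> V" for v
  proof -
    have "?f y = ?g v" if "adj v y" for y
      using dst_nb[OF that, of w] dst_nb_ne[OF assms that] by auto
    then have "(\<Sum>y\<in>{y. adj v y}. ?f y) = (\<Sum>y\<in>{y. adj v y}. ?g v)" by (intro sum.cong) auto
    then show ?thesis using regular[OF that] by simp
  qed
  have "real k * (\<Sum>y\<in>V. ?f y) = (\<Sum>v\<in>V. \<Sum>y\<in>{y. adj v y}. ?f y)" by (rule sum_nb_swap[symmetric])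
  also have "\<dots> = (\<Sum>v\<in>V. real k * ?g v)" using nb by (rule sum.cong[OF refl])
  also have "\<dots> = real k * (\<Sum>v\<in>V. ?g v)" by (rule sum_distrib_left[symmetric])
  finally have "(\<Sum>y\<in>V. ?f y) = (\<Sum>y\<in>V. ?g y)" using k_ge by simp
  then show ?thesis using finite_V by (simp flip: sum.inter_filter)
qed

lemma card_side:
  assumes "w \<in> V"
  shows "card {x\<in>V. even (dst w x)} = half_moore + 2" "card {x\<in>V. odd (dst w x)} = half_moore + 2"
proof -
  have "card V = card {x\<in>V. even (dst w x)} + card {x\<in>V. odd (dst w x)}"
    using finite_V by (subst card_Un_disjoint[symmetric]) (auto intro: arg_cong[where f = card])
  moreover have "card V = 2 * half_moore + 4"
    using card_V by (simp add: moore_bound_even_def half_moore_def)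
  ultimately show "card {x\<in>V. even (dst w x)} = half_moore + 2"
      "card {x\<in>V. odd (dst w x)} = half_moore + 2"
    using card_sides_eq[OF assms] by auto
qed

text \<open>The vertices whose distance from \<open>w\<close> has the parity of \<open>d + 1\<close>
  form one side, of size \<open>half_moore + 2\<close>. Those at distance at most
  \<open>d - 1\<close> account for \<open>half_moore\<close> of them.\<close>

lemma card_antipodes:
  assumes "w \<in> V"
  shows "card {x\<in>V. dst w x = d + 1} = 2"
proof -
  have eq: "{x\<in>V. odd (dst w x + d)} =
      {x\<in>V. dst w x < d \<and> odd (dst w x + d)} \<union> {x\<in>V. dst w x = d + 1}"
  proof (intro equalityI subsetI)
    fix x assume x: "x \<in> {x\<in>V. odd (dst w x + d)}"
    then have "dst w x \<le> d + 1" "dst w x \<noteq> d" using diameter_le[OF assms] by auto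
    then have "dst w x < d \<or> dst w x = d + 1" by linarith
    then show "x \<in> {x\<in>V. dst w x < d \<and> odd (dst w x + d)} \<union> {x\<in>V. dst w x = d + 1}"
      using x by auto
  qed auto
  have "card {x\<in>V. odd (dst w x + d)} = half_moore + 2"
    using card_side[OF assms] by (cases "even d") simp_all
  moreover have "card {x\<in>V. odd (dst w x + d)} = half_moore + card {x\<in>V. dst w x = d + 1}"
    unfolding eq using finite_V card_parity_ball[OF assms]
    by (subst card_Un_disjoint) auto
  ultimately show ?thesis by simp
qed

end

section \<open>Two-regular graphs\<close>

text \<open>Walk along \<open>R\<close> without turning back until a vertex repeats for the first
  time; degree two forces the repeated vertex to be the start. The predecessor index is written
  \<open>(i + l - 1) mod l\<close> because subtraction on naturals truncates at 0.\<close>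

lemma two_regular_cycle:
  assumes "finite V" "V \<noteq> {}" and R: "R \<subseteq> V \<times> V" "sym R" "irrefl R"
    and two: "\<And>v. v \<in> V \<Longrightarrow> card {u. (v, u) \<in> R} = 2"
  obtains l :: nat and v :: "nat \<Rightarrow> 'a" where "3 \<le> l" "inj_on v {..<l}" "v ` {..<l} \<subseteq> V"
    "\<And>i. i < l \<Longrightarrow> {u. (v i, u) \<in> R} = {v ((i + 1) mod l), v ((i + l - 1) mod l)}"
proof -
  have other: "\<exists>c. (b, c) \<in> R \<and> c \<noteq> a" if "b \<in> V" for a b
  proof (rule ccontr)
    assume "\<not> ?thesis"
    then have "{u. (b, u) \<in> R} \<subseteq> {a}" by auto
    then have "card {u. (b, u) \<in> R} \<le> card {a}" by (rule card_mono[rotated]) simp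
    then show False using two that by simp
  qed
  obtain v0 where "v0 \<in> V" using assms by auto
  with other obtain v1 where v1: "(v0, v1) \<in> R" by blast
  \<comment> \<open>The walk is chosen as a sequence of arcs, because not turning back is a
    condition on the last two vertices.\<close>
  have "\<exists>s. \<forall>n. s n \<in> R \<and> fst (s (Suc n)) = snd (s n) \<and> snd (s (Suc n)) \<noteq> fst (s n)"
  proof (rule dependent_nat_choice)
    show "\<exists>x. x \<in> R" using v1 by blast
    show "\<exists>y. y \<in> R \<and> fst y = snd x \<and> snd y \<noteq> fst x" if "x \<in> R" for x n
      using other[of "snd x" "fst x"] that R by (cases x) auto
  qed
  then obtain s where s: "\<And>n. s n \<in> R" "\<And>n. fst (s (Suc n)) = snd (s n)"
      "\<And>n. snd (s (Suc n)) \<noteq> fst (s n)" by blast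
  define w where "w n = fst (s n)" for n
  have wR: "(w n, w (Suc n)) \<in> R" for n using s(1)[of n] s(2)[of n] by (simp add: w_def)
  have w2: "w (Suc (Suc n)) \<noteq> w n" for n using s(2)[of "Suc n"] s(3)[of n] by (simp add: w_def)
  have wV: "w n \<in> V" for n using wR[of n] R by auto
  have wirr: "w (Suc n) \<noteq> w n" for n using wR[of n] R(3) by (auto simp: irrefl_def)
  have nbI: "{u. (x, u) \<in> R} = {a, b}" if "(x, a) \<in> R" "(x, b) \<in> R" "a \<noteq> b" for x a b
  proof -
    have "x \<in> V" using that R by auto
    moreover have "finite {u. (x, u) \<in> R}" using two[OF \<open>x \<in> V\<close>] card.infinite by fastforce
    ultimately show ?thesis using that two[of x] by (intro card_subset_eq[symmetric]) auto
  qed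
  have nb: "{u. (w (Suc n), u) \<in> R} = {w n, w (Suc (Suc n))}" for n
    using wR[of n] wR[of "Suc n"] w2[of n] R(2) by (intro nbI) (auto dest: symD)
  have "\<exists>m. \<exists>i<m. w m = w i"
  proof -
    have "\<not> inj w" using finite_imageD[of w UNIV] wV assms(1)
      by (metis finite_subset image_subsetI infinite_UNIV_nat)
    then obtain i j where "i \<noteq> j" "w i = w j" by (auto simp: inj_def)
    then show ?thesis by (cases i j rule: linorder_cases) metis+
  qed
  then obtain L where L: "\<exists>i<L. w L = w i" and Lmin: "\<And>m. m < L \<Longrightarrow> \<not> (\<exists>i<m. w m = w i)"
    using exists_least_iff[of "\<lambda>m. \<exists>i<m. w m = w i"] by blast
  have inj: "inj_on w {..<L}"
    by (rule linorder_inj_onI) (use Lmin in \<open>force+\<close>)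
  have injD: "i = j" if "w i = w j" "i < L" "j < L" for i j using inj_onD[OF inj that(1)] that by simp
  \<comment> \<open>If \<open>w L = w i\<close> with \<open>i > 0\<close>, the vertex before
    \<open>w L\<close> is one of the two neighbours of \<open>w i\<close> on the walk. By minimality
    of \<open>L\<close> this leaves only \<open>L = i + 1\<close>, a loop, or
    \<open>L = i + 2\<close>, a step back.\<close>
  have L_wrap: "w L = w 0"
  proof -
    obtain i where i: "i < L" "w L = w i" using L by blast
    obtain L' where L': "L = Suc L'" using i by (cases L) auto
    show ?thesis
    proof (cases i)
      case (Suc j)
      have "(w L, w L') \<in> R" using wR[of L'] R(2) L' by (auto dest: symD)
      then have "w L' \<in> {u. (w (Suc j), u) \<in> R}" using i Suc by simp
      then have "w L' = w j \<or> w L' = w (Suc i)" unfolding nb using Suc by simp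
      then show ?thesis
      proof
        assume "w L' = w j"
        then show ?thesis using injD[of L' j] i Suc L' by simp
      next
        assume eq: "w L' = w (Suc i)"
        show ?thesis
        proof (cases "Suc i = L")
          case True
          then show ?thesis using i wirr[of i] by simp
        next
          case False
          then have "L' = Suc i" using injD[of L' "Suc i"] i eq L' by simp
          then show ?thesis using w2[of i] i L' by simp
        qed
      qed
    qed (use i in simp)
  qed
  have "L \<noteq> 0" "L \<noteq> 1" "L \<noteq> 2" using L L_wrap wirr[of 0] w2[of 0] by (auto simp: numeral_2_eq_2)
  then have L3: "3 \<le> L" by linarith
  then obtain K where "L = 3 + K" unfolding le_iff_add ..
  then have K: "L = Suc (Suc (Suc K))" by simp
  show ?thesis
  proof
    show "3 \<le> L" "inj_on w {..<L}" "w ` {..<L} \<subseteq> V" using L3 inj wV by auto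
    fix i assume i: "i < L"
    show "{u. (w i, u) \<in> R} = {w ((i + 1) mod L), w ((i + L - 1) mod L)}"
    proof (cases i)
      case 0
      have "(w 0, w (Suc (Suc K))) \<in> R" using wR[of "Suc (Suc K)"] L_wrap K R(2) by (auto dest: symD)
      moreover have "w 1 \<noteq> w (Suc (Suc K))" using injD[of 1 "Suc (Suc K)"] K by auto
      ultimately have "{u. (w 0, u) \<in> R} = {w 1, w (Suc (Suc K))}" using wR[of 0] by (intro nbI) auto
      then show ?thesis using 0 K by simp
    next
      case (Suc j)
      have 1: "(i + L - 1) mod L = j" using Suc i by simp
      have 2: "w ((i + 1) mod L) = w (Suc i)"
      proof (cases "Suc i = L")
        case True
        then show ?thesis using L_wrap by simp
      next
        case False
        then show ?thesis using i by simp
      qed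
      show ?thesis unfolding 1 2 using nb[of j] Suc by (simp add: insert_commute)
    qed
  qed
qed

text \<open>Split off one cycle \<open>D\<close> and induct. No arc joins \<open>D\<close> to its
  complement, since the two neighbours of a vertex of \<open>D\<close> are those on the cycle; so
  the rest is again 2-regular. The new cycle receives the last index.\<close>

lemma two_regular_disjoint_cycles:
  assumes "finite V" and "R \<subseteq> V \<times> V" "sym R" "irrefl R"
    and "\<And>v. v \<in> V \<Longrightarrow> card {u. (v, u) \<in> R} = 2"
  shows "\<exists>c C l. (\<forall>i<c. cycle_graph (l i) (C i)) \<and> disjoint_union_of \<lparr>pverts = V, parcs = R\<rparr> c C"
  using assms
proof (induction "card V" arbitrary: V R rule: less_induct)
  case less
  show ?case
  proof (cases "V = {}")
    case True
    then show ?thesis using less.prems by (intro exI[of _ 0]) (auto simp: disjoint_union_of_def)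
  next
    case False
    have "\<exists>(m::nat) v. 3 \<le> m \<and> inj_on v {..<m} \<and> v ` {..<m} \<subseteq> V \<and>
        (\<forall>i<m. {u. (v i, u) \<in> R} = {v ((i + 1) mod m), v ((i + m - 1) mod m)})"
      by (rule two_regular_cycle[OF less.prems(1) False less.prems(2-5)]) blast+
    then obtain m :: nat and v where v: "3 \<le> m" "inj_on v {..<m}" "v ` {..<m} \<subseteq> V"
      and nb: "\<And>i. i < m \<Longrightarrow> {u. (v i, u) \<in> R} = {v ((i + 1) mod m), v ((i + m - 1) mod m)}"
      by blast
    define D where "D = \<lparr>pverts = v ` {..<m},
      parcs = (\<Union>i<m. {(v i, v ((i + 1) mod m)), (v ((i + 1) mod m), v i)})\<rparr>"
    have D: "cycle_graph m D" using v unfolding cycle_graph_def D_def by auto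
    have DR: "parcs D = {(a, b) \<in> R. a \<in> pverts D}"
    proof (intro equalityI subrelI)
      fix a b assume "(a, b) \<in> parcs D"
      then obtain i where i: "i < m" "(a, b) = (v i, v ((i + 1) mod m)) \<or> (a, b) = (v ((i + 1) mod m), v i)"
        by (auto simp: D_def)
      moreover have "(v i, v ((i + 1) mod m)) \<in> R" using nb[OF i(1)] by auto
      moreover have "(i + 1) mod m < m" using i by simp
      ultimately show "(a, b) \<in> {(a, b) \<in> R. a \<in> pverts D}"
        using less.prems(3) by (auto simp: D_def dest: symD)
    next
      fix a b assume "(a, b) \<in> {(a, b) \<in> R. a \<in> pverts D}"
      then obtain i where i: "i < m" "a = v i" "(v i, b) \<in> R" by (auto simp: D_def)
      define j where "j = (i + m - 1) mod m"
      have j: "j < m" "(j + 1) mod m = i"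
      proof -
        show "j < m" using i by (simp add: j_def)
        have "(j + 1) mod m = (i + m - 1 + 1) mod m" unfolding j_def by (rule mod_add_left_eq)
        then show "(j + 1) mod m = i" using i by simp
      qed
      have "b = v ((i + 1) mod m) \<or> b = v j" using nb[OF i(1)] i(3) unfolding j_def by blast
      then show "(a, b) \<in> parcs D"
      proof
        assume "b = v j"
        then have "(a, b) = (v ((j + 1) mod m), v j)" using i j by simp
        then show ?thesis using j(1) unfolding D_def by auto
      qed (use i in \<open>auto simp: D_def\<close>)
    qed
    have DR': "(a, b) \<in> parcs D \<longleftrightarrow> (a, b) \<in> R \<and> b \<in> pverts D" for a b
    proof -
      have "(a, b) \<in> parcs D \<longleftrightarrow> (b, a) \<in> parcs D" by (auto simp: D_def)
      then show ?thesis using DR less.prems(3) by (auto dest: symD)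
    qed
    define V' where "V' = V - pverts D"
    define R' where "R' = R - parcs D"
    have "pverts D \<subseteq> V" "pverts D \<noteq> {}" using v unfolding D_def by (auto simp: lessThan_empty_iff)
    then have "card V' < card V" unfolding V'_def using less.prems(1) by (intro psubset_card_mono) auto
    moreover have "R' \<subseteq> V' \<times> V'" using less.prems(2) DR DR' unfolding R'_def V'_def by auto
    moreover have "sym R'" unfolding R'_def
      by (rule symI) (use less.prems(3) DR DR' in \<open>auto dest: symD\<close>)
    moreover have "card {u. (x, u) \<in> R'} = 2" if "x \<in> V'" for x
    proof -
      have "{u. (x, u) \<in> R'} = {u. (x, u) \<in> R}" using that DR unfolding R'_def V'_def by auto
      then show ?thesis using less.prems(5) that by (simp add: V'_def)
    qed
    moreover have "finite V'" "irrefl R'" using less.prems by (auto simp: V'_def R'_def irrefl_def)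
    ultimately obtain c C l where C: "\<forall>i<c. cycle_graph (l i) (C i)"
        "disjoint_union_of \<lparr>pverts = V', parcs = R'\<rparr> c C"
      using less.hyps[of V' R'] by blast
    define C' where "C' i = (if i = c then D else C i)" for i
    define l' where "l' i = (if i = c then m else l i)" for i
    have "\<forall>i<Suc c. cycle_graph (l' i) (C' i)" using C D by (auto simp: C'_def l'_def less_Suc_eq)
    moreover have "disjoint_union_of \<lparr>pverts = V, parcs = R\<rparr> (Suc c) C'"
    proof -
      have un: "(\<Union>i<Suc c. f (C' i)) = f D \<union> (\<Union>i<c. f (C i))" for f :: "_ \<Rightarrow> 'b set"
        by (auto simp: C'_def lessThan_Suc)
      have "V = pverts D \<union> V'" using \<open>pverts D \<subseteq> V\<close> by (auto simp: V'_def)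
      moreover have "R = parcs D \<union> R'" using DR by (auto simp: R'_def)
      moreover have "pverts (C i) \<inter> pverts D = {}" if "i < c" for i
        using that C(2) by (auto simp: disjoint_union_of_def V'_def)
      ultimately show ?thesis using C(2) unfolding disjoint_union_of_def
        by (simp add: un) (auto simp: C'_def less_Suc_eq Int_commute)
    qed
    ultimately show ?thesis by blast
  qed
qed

text \<open>All vertices are indexed at once by pairs (cycle, position), so that adjacency becomes a
  cyclic shift of the position. The Fourier eigenvectors are written in these coordinates.\<close>

lemma disjoint_cycles_param:
  assumes "\<forall>i<c. cycle_graph (l i) (C i)" "disjoint_union_of G c C"
  obtains v :: "nat \<times> nat \<Rightarrow> 'a" where "bij_betw v (SIGMA i:{..<c}. {..<l i}) (pverts G)"
    "\<And>i. i < c \<Longrightarrow> pverts (C i) = (\<lambda>t. v (i, t)) ` {..<l i}"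
    "\<And>i s u. i < c \<Longrightarrow> s < l i \<Longrightarrow>
      (v (i, s), u) \<in> parcs G \<longleftrightarrow> u = v (i, (s + 1) mod l i) \<or> u = v (i, (s + l i - 1) mod l i)"
proof -
  have "\<forall>i\<in>{..<c}. \<exists>v. inj_on v {..<l i} \<and> pverts (C i) = v ` {..<l i} \<and>
     parcs (C i) = (\<Union>j<l i. {(v j, v ((j + 1) mod l i)), (v ((j + 1) mod l i), v j)})"
    using assms(1) by (simp add: cycle_graph_def)
  from bchoice[OF this] obtain w where
    w: "\<forall>i\<in>{..<c}. inj_on (w i) {..<l i} \<and> pverts (C i) = w i ` {..<l i} \<and>
      parcs (C i) = (\<Union>j<l i. {(w i j, w i ((j + 1) mod l i)), (w i ((j + 1) mod l i), w i j)})"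
    by blast
  have inj: "\<And>i. i < c \<Longrightarrow> inj_on (w i) {..<l i}"
    and vs: "\<And>i. i < c \<Longrightarrow> pverts (C i) = w i ` {..<l i}"
    and arcs: "\<And>i. i < c \<Longrightarrow>
      parcs (C i) = (\<Union>j<l i. {(w i j, w i ((j + 1) mod l i)), (w i ((j + 1) mod l i), w i j)})"
    using w by blast+
  have disj: "i = i'" if "i < c" "i' < c" "x \<in> pverts (C i)" "x \<in> pverts (C i')" for i i' x
    using assms(2) that unfolding disjoint_union_of_def by blast
  have Gv: "pverts G = (\<Union>i<c. pverts (C i))" and Ga: "parcs G = (\<Union>i<c. parcs (C i))"
    using assms(2) unfolding disjoint_union_of_def by auto
  define v where "v = (\<lambda>(i, t). w i t)"
  have 1: "bij_betw v (SIGMA i:{..<c}. {..<l i}) (pverts G)"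
  proof (rule bij_betw_imageI)
    show "inj_on v (SIGMA i:{..<c}. {..<l i})"
    proof (rule inj_onI, clarify)
      fix i s i' s' assume *: "i < c" "i' < c" "s < l i" "s' < l i'" "v (i, s) = v (i', s')"
      have "w i s \<in> pverts (C i)" unfolding vs[OF *(1)] using *(3) by blast
      moreover have "w i' s' \<in> pverts (C i')" unfolding vs[OF *(2)] using *(4) by blast
      ultimately have "i = i'" using disj * by (simp add: v_def)
      then show "i = i' \<and> s = s'" using inj_onD[OF inj[of i]] * by (auto simp: v_def)
    qed
    show "v ` (SIGMA i:{..<c}. {..<l i}) = pverts G"
      using vs by (force simp: Gv v_def)
  qed
  have 3: "(v (i, s), u) \<in> parcs G \<longleftrightarrow> u = v (i, (s + 1) mod l i) \<or> u = v (i, (s + l i - 1) mod l i)"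
    if i: "i < c" and s: "s < l i" for i s u
  proof -
    have ws: "w i s \<in> pverts (C i)" using vs i s by auto
    have pred: "(j + 1) mod l i = s \<longleftrightarrow> j = (s + l i - 1) mod l i" if "j < l i" for j
      using that s by (cases "j + 1 = l i"; cases s) auto
    have cl: "a \<in> pverts (C i')" if "i' < c" "(a, b) \<in> parcs (C i')" for i' a b
    proof -
      have "0 < l i'" using that arcs by (cases "l i'") auto
      then show ?thesis using that arcs vs by auto
    qed
    have "(w i s, u) \<in> parcs G \<longleftrightarrow> (w i s, u) \<in> parcs (C i)"
      unfolding Ga using cl disj[OF _ i _ ws] i by blast
    also have "\<dots> \<longleftrightarrow> (\<exists>j<l i. s = j \<and> u = w i ((j + 1) mod l i) \<or> s = (j + 1) mod l i \<and> u = w i j)"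
    proof -
      have "0 < l i" using s by simp
      then have "w i s = w i j \<longleftrightarrow> s = j" "w i s = w i ((j + 1) mod l i) \<longleftrightarrow> s = (j + 1) mod l i"
        if "j < l i" for j
        using inj_on_eq_iff[OF inj[OF i]] s that by simp_all
      then show ?thesis unfolding arcs[OF i] by auto
    qed
    also have "\<dots> \<longleftrightarrow> u = w i ((s + 1) mod l i) \<or> u = w i ((s + l i - 1) mod l i)"
    proof -
      have "(s + l i - 1) mod l i < l i" using s by simp
      with pred have p: "((s + l i - 1) mod l i + 1) mod l i = s" by blast
      show ?thesis (is "?L \<longleftrightarrow> ?R")
      proof
        assume ?L
        then obtain j where j: "j < l i"
            "s = j \<and> u = w i ((j + 1) mod l i) \<or> s = (j + 1) mod l i \<and> u = w i j" by blast
        from j(2) show ?R using pred[OF j(1)] by metis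
      next
        assume ?R
        then show ?L
        proof
          assume "u = w i ((s + 1) mod l i)"
          then show ?L using s by blast
        next
          assume "u = w i ((s + l i - 1) mod l i)"
          then show ?L using p \<open>(s + l i - 1) mod l i < l i\<close> by metis
        qed
      qed
    qed
    finally show ?thesis by (simp add: v_def)
  qed
  have 2: "pverts (C i) = (\<lambda>t. v (i, t)) ` {..<l i}" if "i < c" for i using vs[OF that] by (simp add: v_def)
  show ?thesis using 1 2 3 by (rule that)
qed

section \<open>Characteristic polynomials\<close>

lemma index_mult_mat_sum:
  assumes "A \<in> carrier_mat n m" "B \<in> carrier_mat m p" "i < n" "j < p"
  shows "(A * B) $$ (i, j) = (\<Sum>a<m. A $$ (i, a) * B $$ (a, j))"
  using assms by (simp add: scalar_prod_def atLeast0LessThan)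

section \<open>Symmetric matrices have real spectrum\<close>

lemma symmetric_eigenvalue_real:
  fixes A :: "real mat"
  assumes A: "A \<in> carrier_mat n n" and sym: "\<And>i j. i < n \<Longrightarrow> j < n \<Longrightarrow> A $$ (i, j) = A $$ (j, i)"
    and ev: "eigenvalue (map_mat complex_of_real A) a"
  shows "a \<in> \<real>"
proof -
  let ?A = "map_mat complex_of_real A"
  obtain v where "eigenvector ?A v a" using ev unfolding eigenvalue_def by blast
  then have v: "v \<in> carrier_vec n" "v \<noteq> 0\<^sub>v n" "?A *\<^sub>v v = a \<cdot>\<^sub>v v"
    using A by (auto simp: eigenvector_def)
  have Av: "(\<Sum>j<n. complex_of_real (A $$ (i, j)) * v $ j) = a * v $ i" if "i < n" for i
  proof -
    have "(?A *\<^sub>v v) $ i = (\<Sum>j<n. complex_of_real (A $$ (i, j)) * v $ j)"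
      using that A v(1) by (simp add: scalar_prod_def atLeast0LessThan)
    then show ?thesis using v that by simp
  qed
  \<comment> \<open>\<open>S\<close> is the squared norm of the eigenvector and \<open>a * S\<close>
    the value of the Hermitian form of \<open>A\<close> there; by symmetry of \<open>A\<close> both
    equal their conjugates, hence so does \<open>a\<close>.\<close>
  define S where "S = (\<Sum>i<n. cnj (v $ i) * v $ i)"
  have S: "S = complex_of_real (\<Sum>i<n. (cmod (v $ i))\<^sup>2)"
    unfolding S_def of_real_sum by (intro sum.cong refl) (simp add: mult.commute complex_norm_square[symmetric])
  have "S \<noteq> 0"
  proof
    assume "S = 0"
    then have "(\<Sum>i<n. (cmod (v $ i))\<^sup>2) = 0" using S by (metis of_real_eq_0_iff)
    then have "\<forall>i<n. v $ i = 0" by (subst (asm) sum_nonneg_eq_0_iff) auto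
    then show False using v by auto
  qed
  have "a * S = (\<Sum>i<n. \<Sum>j<n. cnj (v $ i) * complex_of_real (A $$ (i, j)) * v $ j)"
  proof -
    have "a * S = (\<Sum>i<n. cnj (v $ i) * (a * v $ i))"
      by (simp add: S_def sum_distrib_left mult_ac)
    also have "\<dots> = (\<Sum>i<n. cnj (v $ i) * (\<Sum>j<n. complex_of_real (A $$ (i, j)) * v $ j))"
      using Av by simp
    finally show ?thesis by (simp add: sum_distrib_left mult.assoc)
  qed
  moreover have "cnj (\<Sum>i<n. \<Sum>j<n. cnj (v $ i) * complex_of_real (A $$ (i, j)) * v $ j) =
      (\<Sum>i<n. \<Sum>j<n. cnj (v $ j) * complex_of_real (A $$ (j, i)) * v $ i)"
    unfolding cnj_sum by (intro sum.cong refl) (simp add: sym mult_ac)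
  moreover have "(\<Sum>i<n. \<Sum>j<n. cnj (v $ j) * complex_of_real (A $$ (j, i)) * v $ i) =
      (\<Sum>i<n. \<Sum>j<n. cnj (v $ i) * complex_of_real (A $$ (i, j)) * v $ j)"
    by (rule sum.swap)
  ultimately have "cnj (a * S) = a * S" by simp
  moreover have "cnj S = S" unfolding S by simp
  ultimately have "cnj a = a" using \<open>S \<noteq> 0\<close> by simp
  then show ?thesis by (simp add: Reals_cnj_iff)
qed

interpretation of_real_poly: map_poly_inj_idom_hom complex_of_real ..

text \<open>Factor over the complex numbers, where all roots are real, and pull the factorization
  back along the injective embedding of real polynomials.\<close>

lemma symmetric_char_poly_splits:
  fixes A :: "real mat"
  assumes A: "A \<in> carrier_mat n n" and sym: "\<And>i j. i < n \<Longrightarrow> j < n \<Longrightarrow> A $$ (i, j) = A $$ (j, i)"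
  obtains rs where "char_poly A = (\<Prod>r\<leftarrow>rs. [:- r, 1:])"
proof -
  let ?A = "map_mat complex_of_real A"
  have cA: "?A \<in> carrier_mat n n" using A by simp
  obtain as where as: "char_poly ?A = (\<Prod>a\<leftarrow>as. [:- a, 1:])" using char_poly_factorized[OF cA] by blast
  have "a \<in> \<real>" if "a \<in> set as" for a
  proof -
    have "poly (char_poly ?A) a = 0" unfolding as using that
      by (auto simp: poly_prod_list prod_list_zero_iff)
    then have "eigenvalue ?A a" using eigenvalue_root_char_poly[OF cA] by simp
    then show ?thesis using symmetric_eigenvalue_real[OF A sym] by blast
  qed
  then have "as = map complex_of_real (map Re as)" by (induction as) auto
  then obtain rs where rs: "as = map complex_of_real rs" by blast
  have "map_poly complex_of_real (char_poly A) = map_poly complex_of_real (\<Prod>r\<leftarrow>rs. [:- r, 1:])"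
    using as of_real_hom.char_poly_hom[OF A, where ?'a = complex]
    by (simp add: rs of_real_poly.hom_prod_list o_def)
  then show ?thesis using that of_real_poly.injectivity by blast
qed

section \<open>Spectral mapping for the polynomials \<open>H_i\<close>\<close>

lemma upper_triangular_mult:
  fixes A B :: "'a :: semiring_0 mat"
  assumes A: "A \<in> carrier_mat n n" "upper_triangular A" and B: "B \<in> carrier_mat n n" "upper_triangular B"
  shows "upper_triangular (A * B)" "i < n \<Longrightarrow> (A * B) $$ (i, i) = A $$ (i, i) * B $$ (i, i)"
proof -
  have Az: "A $$ (i, j) = 0" if "j < i" "i < n" for i j using upper_triangularD[OF A(2)] that A(1) by auto
  have Bz: "B $$ (i, j) = 0" if "j < i" "i < n" for i j using upper_triangularD[OF B(2)] that B(1) by auto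
  show "upper_triangular (A * B)"
  proof
    fix i j assume ij: "j < i" "i < dim_row (A * B)"
    then have "i < n" "j < n" using A(1) by auto
    then have "(A * B) $$ (i, j) = (\<Sum>a<n. A $$ (i, a) * B $$ (a, j))"
      by (rule index_mult_mat_sum[OF A(1) B(1)])
    also have "\<dots> = 0"
    proof (rule sum.neutral, rule ballI)
      fix a assume "a \<in> {..<n}"
      then show "A $$ (i, a) * B $$ (a, j) = 0"
        using Az[of a i] Bz[of j a] ij A(1) by (cases "a < i") auto
    qed
    finally show "(A * B) $$ (i, j) = 0" .
  qed
  assume i: "i < n"
  then have "(A * B) $$ (i, i) = (\<Sum>a<n. A $$ (i, a) * B $$ (a, i))"
    using A(1) B(1) by (intro index_mult_mat_sum) auto
  also have "\<dots> = (\<Sum>a\<in>{i}. A $$ (i, a) * B $$ (a, i))"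
  proof (rule sum.mono_neutral_right)
    show "\<forall>a\<in>{..<n} - {i}. A $$ (i, a) * B $$ (a, i) = 0"
    proof
      fix a assume a: "a \<in> {..<n} - {i}"
      then consider "a < i" | "i < a" by force
      then show "A $$ (i, a) * B $$ (a, i) = 0" using Az[of a i] Bz[of i a] i a by cases auto
    qed
  qed (use i in auto)
  finally show "(A * B) $$ (i, i) = A $$ (i, i) * B $$ (i, i)" by simp
qed

text \<open>The value of \<open>H_poly k i\<close> at a matrix. Generating it by the recurrence lets
  similarity, triangularity and the entries for a graph each be followed by a two-step
  induction.\<close>

fun H_mat :: "nat \<Rightarrow> real mat \<Rightarrow> nat \<Rightarrow> real mat" where
  "H_mat k A 0 = 1\<^sub>m (dim_row A)"
| "H_mat k A (Suc 0) = A"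
| "H_mat k A (Suc (Suc i)) = H_mat k A (Suc i) * A - (real k - 1) \<cdot>\<^sub>m H_mat k A i"

lemma H_mat_carrier: "A \<in> carrier_mat n n \<Longrightarrow> H_mat k A i \<in> carrier_mat n n"
  by (induction i rule: induct_nat_012) (auto intro!: minus_carrier_mat)

lemma H_mat_upper_triangular:
  assumes B: "B \<in> carrier_mat n n" "upper_triangular B"
  shows "upper_triangular (H_mat k B i)"
    and "j < n \<Longrightarrow> H_mat k B i $$ (j, j) = poly (H_poly k i) (B $$ (j, j))"
proof -
  have "upper_triangular (H_mat k B i) \<and>
    (\<forall>j<n. H_mat k B i $$ (j, j) = poly (H_poly k i) (B $$ (j, j)))"
  proof (induction i rule: induct_nat_012)
    case (ge2 i)
    note c = H_mat_carrier[OF B(1), of k i] H_mat_carrier[OF B(1), of k "Suc i"]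
    let ?M = "H_mat k B (Suc i) * B"
    have M: "?M \<in> carrier_mat n n" using c B by simp
    have ut: "upper_triangular ?M" "\<And>j. j < n \<Longrightarrow> ?M $$ (j, j) = H_mat k B (Suc i) $$ (j, j) * B $$ (j, j)"
      using upper_triangular_mult[OF c(2) _ B] ge2 by auto
    have "upper_triangular (H_mat k B (Suc (Suc i)))"
    proof
      fix a b assume ab: "b < a" "a < dim_row (H_mat k B (Suc (Suc i)))"
      then have a: "a < n" "b < n" using M c by auto
      have "?M $$ (a, b) = 0" "H_mat k B i $$ (a, b) = 0"
        using upper_triangularD[OF ut(1) ab(1)] upper_triangularD[of "H_mat k B i" b a] ge2.IH ab a M c by auto
      then show "H_mat k B (Suc (Suc i)) $$ (a, b) = 0" using a M c by simp
    qed
    moreover have "H_mat k B (Suc (Suc i)) $$ (j, j) = poly (H_poly k (Suc (Suc i))) (B $$ (j, j))"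
      if "j < n" for j
    proof -
      have "H_mat k B (Suc (Suc i)) $$ (j, j) = ?M $$ (j, j) - (real k - 1) * H_mat k B i $$ (j, j)"
        using that M c by (simp del: index_mult_mat)
      then show ?thesis using ut(2)[OF that] ge2.IH that by (simp add: mult.commute)
    qed
    ultimately show ?case by blast
  qed (use B in auto)
  then show "upper_triangular (H_mat k B i)"
    "j < n \<Longrightarrow> H_mat k B i $$ (j, j) = poly (H_poly k i) (B $$ (j, j))" by auto
qed

lemma H_mat_similar:
  assumes c: "A \<in> carrier_mat n n" "B \<in> carrier_mat n n" "P \<in> carrier_mat n n" "Q \<in> carrier_mat n n"
    and PQ: "P * Q = 1\<^sub>m n" "Q * P = 1\<^sub>m n" and A: "A = P * B * Q"
  shows "H_mat k A i = P * H_mat k B i * Q"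
proof (induction i rule: induct_nat_012)
  case 0
  then show ?case using c PQ by simp
next
  case 1
  then show ?case using A by simp
next
  case (ge2 i)
  let ?X = "H_mat k B (Suc i)" and ?Y = "H_mat k B i"
  have XY: "?X \<in> carrier_mat n n" "?Y \<in> carrier_mat n n" using H_mat_carrier c by auto
  have PX: "P * ?X \<in> carrier_mat n n" "P * B \<in> carrier_mat n n" "B * Q \<in> carrier_mat n n"
    "P * ?Y \<in> carrier_mat n n" "?X * B \<in> carrier_mat n n" using c XY by auto
  have "(P * ?X * Q) * (P * B * Q) = P * ?X * (Q * (P * B * Q))"
    using PX c by (intro assoc_mult_mat[of _ n n _ n _ n]) auto
  also have "Q * (P * B * Q) = (Q * P) * (B * Q)"
    unfolding assoc_mult_mat[OF c(3,2,4)] using PX c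
    by (intro assoc_mult_mat[of Q n n P n "B * Q" n, symmetric]) auto
  also have "\<dots> = B * Q" unfolding PQ(2) by (rule left_mult_one_mat[OF PX(3)])
  also have "P * ?X * (B * Q) = P * (?X * B) * Q"
    unfolding assoc_mult_mat[OF PX(1) c(2,4), symmetric] assoc_mult_mat[OF c(3) XY(1) c(2)] ..
  finally have 1: "(P * ?X * Q) * A = P * (?X * B) * Q" using A by simp
  have "P * (?X * B - (real k - 1) \<cdot>\<^sub>m ?Y) * Q = (P * (?X * B) - P * ((real k - 1) \<cdot>\<^sub>m ?Y)) * Q"
    using mult_minus_distrib_mat[of P n n "?X * B" n "(real k - 1) \<cdot>\<^sub>m ?Y"] c XY PX by simp
  also have "\<dots> = P * (?X * B) * Q - P * ((real k - 1) \<cdot>\<^sub>m ?Y) * Q"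
    using c XY PX by (intro minus_mult_distrib_mat[of _ n n _ _ n]) auto
  also have "P * ((real k - 1) \<cdot>\<^sub>m ?Y) * Q = (real k - 1) \<cdot>\<^sub>m (P * ?Y * Q)"
    unfolding mult_smult_distrib[OF c(3) XY(2)] mult_smult_assoc_mat[OF PX(4) c(4)] ..
  finally show ?case using ge2.IH 1 by simp
qed

text \<open>By Schur decomposition \<open>A\<close> is similar to a triangular \<open>B\<close> with
  diagonal \<open>rs\<close>. Then \<open>H_i(A)\<close> is similar to \<open>H_i(B)\<close>, which
  is triangular with diagonal \<open>H_i\<close> of \<open>rs\<close>, so multiplicities are
  preserved.\<close>

lemma char_poly_H_mat:
  assumes A: "A \<in> carrier_mat n n" and rs: "char_poly A = (\<Prod>r\<leftarrow>rs. [:- r, 1:])"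
  shows "char_poly (H_mat k A i) = (\<Prod>r\<leftarrow>rs. [:- poly (H_poly k i) r, 1:])"
proof -
  obtain B P Q where sd: "schur_decomposition A rs = (B, P, Q)" by (metis prod_cases3)
  have wit: "similar_mat_wit A B P Q" and ut: "upper_triangular B" and diag: "diag_mat B = rs"
    using schur_decomposition[OF A rs sd] by auto
  have c: "B \<in> carrier_mat n n" "P \<in> carrier_mat n n" "Q \<in> carrier_mat n n"
    and PQ: "P * Q = 1\<^sub>m n" "Q * P = 1\<^sub>m n" and AP: "A = P * B * Q"
    using similar_mat_witD2[OF A wit] by auto
  note cH = H_mat_carrier[OF A, of k i] H_mat_carrier[OF c(1), of k i]
  have "similar_mat (H_mat k A i) (H_mat k B i)"
    using H_mat_similar[OF A c PQ AP] c PQ cH by (intro similar_matI[of _ _ P Q n]) auto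
  then have "char_poly (H_mat k A i) = char_poly (H_mat k B i)" by (rule char_poly_similar)
  also have "\<dots> = (\<Prod>a\<leftarrow>diag_mat (H_mat k B i). [:- a, 1:])"
    using char_poly_upper_triangular[OF cH(2) H_mat_upper_triangular(1)[OF c(1) ut]] .
  also have "diag_mat (H_mat k B i) = map (poly (H_poly k i)) rs"
    unfolding diag[symmetric] diag_mat_def using cH c(1) H_mat_upper_triangular(2)[OF c(1) ut]
    by simp
  finally show ?thesis by (simp add: o_def)
qed

section \<open>Determinants and rank one updates\<close>

lemma det_one_add_mult_commute:
  fixes U W :: "'a :: idom mat"
  assumes U: "U \<in> carrier_mat n m" and W: "W \<in> carrier_mat m n"
  shows "det (1\<^sub>m n + U * W) = det (1\<^sub>m m + W * U)"
proof -
  \<comment> \<open>Sylvester's identity: multiplying \<open>?M\<close> by \<open>?L\<close> and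
    \<open>?R\<close>, both of determinant 1, moves the product from \<open>1 + U * W\<close> in the
    upper left block to \<open>1 + W * U\<close> in the lower right one.\<close>
  let ?L = "four_block_mat (1\<^sub>m n) (0\<^sub>m n m) W (1\<^sub>m m)"
  let ?M = "four_block_mat (1\<^sub>m n + U * W) U (0\<^sub>m m n) (1\<^sub>m m)"
  let ?R = "four_block_mat (1\<^sub>m n) (0\<^sub>m n m) (- W) (1\<^sub>m m)"
  have c: "U * W \<in> carrier_mat n n" "W * U \<in> carrier_mat m m" using U W by auto
  have UW: "U * - W = - (U * W)"
    using U W by (intro eq_matI) (auto simp: scalar_prod_def sum_negf)
  have "?M * ?R = four_block_mat ((1\<^sub>m n + U * W) * 1\<^sub>m n + U * - W)
      ((1\<^sub>m n + U * W) * 0\<^sub>m n m + U * 1\<^sub>m m) (0\<^sub>m m n * 1\<^sub>m n + 1\<^sub>m m * - W) (0\<^sub>m m n * 0\<^sub>m n m + 1\<^sub>m m * 1\<^sub>m m)"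
    using U W c by (intro mult_four_block_mat) auto
  also have "\<dots> = four_block_mat (1\<^sub>m n) U (- W) (1\<^sub>m m)"
    using U W c unfolding UW by (intro cong_four_block_mat) (auto intro!: eq_matI)
  finally have MR: "?M * ?R = four_block_mat (1\<^sub>m n) U (- W) (1\<^sub>m m)" .
  have "?L * (?M * ?R) = four_block_mat (1\<^sub>m n * 1\<^sub>m n + 0\<^sub>m n m * - W) (1\<^sub>m n * U + 0\<^sub>m n m * 1\<^sub>m m)
      (W * 1\<^sub>m n + 1\<^sub>m m * - W) (W * U + 1\<^sub>m m * 1\<^sub>m m)"
    unfolding MR using U W by (intro mult_four_block_mat) auto
  also have "\<dots> = four_block_mat (1\<^sub>m n) U (0\<^sub>m m n) (1\<^sub>m m + W * U)"
    using U W c by (intro cong_four_block_mat) (auto intro!: eq_matI)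
  finally have LMR: "?L * (?M * ?R) = four_block_mat (1\<^sub>m n) U (0\<^sub>m m n) (1\<^sub>m m + W * U)" .
  have cM: "?M \<in> carrier_mat (n + m) (n + m)" "?L \<in> carrier_mat (n + m) (n + m)"
    "?R \<in> carrier_mat (n + m) (n + m)" using U W c by auto
  have dL: "det ?L = 1" "det ?R = 1"
    using W by (subst det_four_block_mat_upper_right_zero[of _ n _ m], auto)+
  have dM: "det ?M = det (1\<^sub>m n + U * W)"
    using U c by (subst det_four_block_mat_lower_left_zero[of _ n _ m]) auto
  have "det (?L * (?M * ?R)) = det (1\<^sub>m m + W * U)"
    unfolding LMR using U c by (subst det_four_block_mat_lower_left_zero[of _ n _ m]) auto
  moreover have "det (?L * (?M * ?R)) = det ?L * (det ?M * det ?R)"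
    using cM det_mult[of ?L "n + m" "?M * ?R"] det_mult[of ?M "n + m" ?R] by simp
  ultimately show ?thesis using dL dM by simp
qed

lemma poly_char_poly_eq_det:
  fixes A :: "'a :: field mat"
  assumes "A \<in> carrier_mat n n"
  shows "poly (char_poly A) x = det (x \<cdot>\<^sub>m 1\<^sub>m n - A)"
  unfolding char_poly_matrix[OF assms] char_matrix_def
  using assms by (intro arg_cong[where f = det] eq_matI) auto

text \<open>Brauer: \<open>(x - M) (1 - s w\<^sup>T / (x - \<mu>)) = x - M - s w\<^sup>T\<close> by the eigenvector equation.\<close>

lemma char_poly_rank_one_update:
  fixes M :: "'a :: field_char_0 mat"
  assumes M: "M \<in> carrier_mat n n"
    and ev: "\<And>i. i < n \<Longrightarrow> (\<Sum>j<n. M $$ (i, j) * s j) = \<mu> * s i"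
  shows "char_poly (mat n n (\<lambda>(i, j). M $$ (i, j) + s i * w j)) * [:- \<mu>, 1:] =
         char_poly M * [:- (\<mu> + (\<Sum>j<n. w j * s j)), 1:]"
proof -
  let ?N = "mat n n (\<lambda>(i, j). M $$ (i, j) + s i * w j)"
  define \<sigma> where "\<sigma> = (\<Sum>j<n. w j * s j)"
  have N: "?N \<in> carrier_mat n n" by simp
  have pointwise: "poly (char_poly ?N) x * (x - \<mu>) = poly (char_poly M) x * (x - (\<mu> + \<sigma>))" if x: "x \<noteq> \<mu>" for x
  proof -
    define U where "U = mat n 1 (\<lambda>(i, j). s i)"
    define W where "W = mat 1 n (\<lambda>(i, j). - w j / (x - \<mu>))"
    have c: "U \<in> carrier_mat n 1" "W \<in> carrier_mat 1 n" "U * W \<in> carrier_mat n n"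
      "x \<cdot>\<^sub>m 1\<^sub>m n - M \<in> carrier_mat n n" using M by (auto simp: U_def W_def)
    have UW: "(U * W) $$ (i, j) = s i * (- w j / (x - \<mu>))" if "i < n" "j < n" for i j
      using index_mult_mat_sum[OF c(1,2) that] that by (simp add: U_def W_def)
    have xM: "(\<Sum>a<n. (x \<cdot>\<^sub>m 1\<^sub>m n - M) $$ (i, a) * s a) = (x - \<mu>) * s i" if "i < n" for i
    proof -
      have "(\<Sum>a<n. (x \<cdot>\<^sub>m 1\<^sub>m n - M) $$ (i, a) * s a) =
          (\<Sum>a<n. (if i = a then x * s a else 0) - M $$ (i, a) * s a)"
        using that M by (intro sum.cong) (auto simp: algebra_simps)
      then show ?thesis using ev that by (simp add: sum_subtractf algebra_simps)
    qed
    have "(x \<cdot>\<^sub>m 1\<^sub>m n - M) * (1\<^sub>m n + U * W) = (x \<cdot>\<^sub>m 1\<^sub>m n - M) + (x \<cdot>\<^sub>m 1\<^sub>m n - M) * (U * W)"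
      using mult_add_distrib_mat[OF c(4) one_carrier_mat c(3)] unfolding right_mult_one_mat[OF c(4)] .
    also have "\<dots> = x \<cdot>\<^sub>m 1\<^sub>m n - ?N"
    proof (rule eq_matI)
      fix i j assume "i < dim_row (x \<cdot>\<^sub>m 1\<^sub>m n - ?N)" "j < dim_col (x \<cdot>\<^sub>m 1\<^sub>m n - ?N)"
      then have ij: "i < n" "j < n" by auto
      have "((x \<cdot>\<^sub>m 1\<^sub>m n - M) * (U * W)) $$ (i, j) =
          (\<Sum>a<n. (x \<cdot>\<^sub>m 1\<^sub>m n - M) $$ (i, a) * (U * W) $$ (a, j))"
        by (rule index_mult_mat_sum[OF c(4,3) ij])
      also have "\<dots> = (\<Sum>a<n. (x \<cdot>\<^sub>m 1\<^sub>m n - M) $$ (i, a) * s a) * (- w j / (x - \<mu>))"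
        unfolding sum_distrib_right using UW ij by (intro sum.cong) (auto simp del: index_mult_mat index_minus_mat)
      also have "\<dots> = - (s i * w j)" unfolding xM[OF ij(1)] using x by simp
      finally have "((x \<cdot>\<^sub>m 1\<^sub>m n - M) * (U * W)) $$ (i, j) = - (s i * w j)" .
      then show "((x \<cdot>\<^sub>m 1\<^sub>m n - M) + (x \<cdot>\<^sub>m 1\<^sub>m n - M) * (U * W)) $$ (i, j) = (x \<cdot>\<^sub>m 1\<^sub>m n - ?N) $$ (i, j)"
        using ij M c by (simp del: index_mult_mat(1))
    qed (use M c in auto)
    finally have "x \<cdot>\<^sub>m 1\<^sub>m n - ?N = (x \<cdot>\<^sub>m 1\<^sub>m n - M) * (1\<^sub>m n + U * W)" by simp
    then have "poly (char_poly ?N) x = det ((x \<cdot>\<^sub>m 1\<^sub>m n - M) * (1\<^sub>m n + U * W))"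
      using poly_char_poly_eq_det[OF N, of x] by simp
    also have "\<dots> = poly (char_poly M) x * det (1\<^sub>m n + U * W)"
      using det_mult[of "x \<cdot>\<^sub>m 1\<^sub>m n - M" n "1\<^sub>m n + U * W"] c poly_char_poly_eq_det[OF M, of x] by simp
    also have "det (1\<^sub>m n + U * W) = det (1\<^sub>m 1 + W * U)" by (rule det_one_add_mult_commute[OF c(1,2)])
    also have "\<dots> = 1 + (W * U) $$ (0, 0)"
      using c by (subst det_upper_triangular[of _ 1]) (auto simp: diag_mat_def simp del: index_mult_mat(1))
    also have "(W * U) $$ (0, 0) = - \<sigma> / (x - \<mu>)"
      using index_mult_mat_sum[OF c(2,1), of 0 0]
      by (simp add: W_def U_def \<sigma>_def sum_negf sum_divide_distrib del: index_mult_mat)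
    finally have "poly (char_poly ?N) x = poly (char_poly M) x * (1 + - \<sigma> / (x - \<mu>))" .
    then show ?thesis using x by (simp add: field_simps)
  qed
  \<comment> \<open>The extra factor vanishes at \<open>x = \<mu>\<close>, the one point not covered
    by \<open>pointwise\<close>; it is cancelled once equality of the polynomials is known.\<close>
  have "poly (char_poly ?N * [:- \<mu>, 1:] * [:- \<mu>, 1:]) x =
      poly (char_poly M * [:- (\<mu> + \<sigma>), 1:] * [:- \<mu>, 1:]) x" for x
  proof -
    have linear: "poly [:- a, 1:] x = x - a" for a by simp
    show ?thesis unfolding poly_mult linear using pointwise[of x] by (cases "x = \<mu>") simp_all
  qed
  then have "poly (char_poly ?N * [:- \<mu>, 1:] * [:- \<mu>, 1:]) =
      poly (char_poly M * [:- (\<mu> + \<sigma>), 1:] * [:- \<mu>, 1:])" by (rule ext)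
  then have eq: "char_poly ?N * [:- \<mu>, 1:] * [:- \<mu>, 1:] = char_poly M * [:- (\<mu> + \<sigma>), 1:] * [:- \<mu>, 1:]"
    unfolding poly_eq_poly_eq_iff .
  have "[:- \<mu>, 1:] \<noteq> 0" by simp
  from iffD1[OF mult_right_cancel[OF this] eq] show ?thesis unfolding \<sigma>_def .
qed

section \<open>Fourier diagonalisation of a union of cycles\<close>

lemma sum_powers_root_of_unity:
  fixes z :: complex
  assumes "z ^ l = 1"
  shows "(\<Sum>t<l. z ^ t) = (if z = 1 then of_nat l else 0)"
  using assms by (simp add: geometric_sum)

lemma power_mod_root_of_unity: "(z :: complex) ^ l = 1 \<Longrightarrow> z ^ (t mod l) = z ^ t"
  by (metis div_mult_mod_eq mult.commute mult_1 power_add power_mult power_one)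

lemma cis_root_of_unity: "0 < l \<Longrightarrow> cis (2 * pi * real j / real l) ^ l = 1"
  using cis_multiple_2pi[of "real j"] by (simp add: DeMoivre)

lemma cis_root_eq_iff:
  assumes "j < l" "j' < l"
  shows "cis (2 * pi * real j / real l) = cis (2 * pi * real j' / real l) \<longleftrightarrow> j = j'"
proof
  assume eq: "cis (2 * pi * real j / real l) = cis (2 * pi * real j' / real l)"
  have "inj_on (\<lambda>k. cis (2 * pi * real k / real l)) {..<l}"
    using bij_betw_roots_unity[of l] assms bij_betw_imp_inj_on by auto
  from inj_onD[OF this eq] assms show "j = j'" by simp
qed simp

text \<open>
  The eigenvectors are the Fourier vectors \<open>(i, t) \<mapsto> exp (2 \<pi> \<ii> j t / l i)\<close> supported on one cycle.
\<close>

lemma char_poly_neg_cycles: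
  fixes v :: "nat \<times> nat \<Rightarrow> 'a" and E :: "real mat" and c :: nat and l :: "nat \<Rightarrow> nat"
  defines "I \<equiv> SIGMA i:{..<c}. {..<l i}"
  assumes l: "\<And>i. i < c \<Longrightarrow> 3 \<le> l i" and vs: "distinct vs" and bij: "bij_betw v I (set vs)"
    and R: "\<And>i s u. i < c \<Longrightarrow> s < l i \<Longrightarrow>
      (v (i, s), u) \<in> R \<longleftrightarrow> u = v (i, (s + 1) mod l i) \<or> u = v (i, (s + l i - 1) mod l i)"
    and E: "E = mat (length vs) (length vs) (\<lambda>(a, b). if (vs ! a, vs ! b) \<in> R then 1 else 0)"
  shows "char_poly (- E) = (\<Prod>(i, j)\<in>I. [:2 * cos (2 * pi * real j / real (l i)), 1:])"
proof -
  define n where "n = length vs"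
  have fin: "finite I" unfolding I_def by auto
  \<comment> \<open>Rows of the eigenvector matrix follow the vertex list \<open>vs\<close>, columns
    the list \<open>qs\<close> of pairs (cycle, frequency); both index sets have the size of
    \<open>I\<close>.\<close>
  obtain qs where qs: "set qs = I" "distinct qs" using finite_distinct_list[OF fin] by blast
  have "card I = n" using bij_betw_same_card[OF bij] distinct_card[OF vs] by (simp add: n_def)
  then have len: "length qs = n" using distinct_card[OF qs(2)] qs(1) by simp
  define iv where "iv = the_inv_into I v"
  have iv: "iv (v p) = p" if "p \<in> I" for p
    unfolding iv_def using the_inv_into_f_f[OF bij_betw_imp_inj_on[OF bij] that] .
  have bij_iv: "bij_betw (\<lambda>a. iv (vs ! a)) {..<n} I"
  proof -
    have "bij_betw ((!) vs) {..<n} (set vs)" using bij_betw_nth[OF vs] by (simp add: n_def)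
    moreover have "bij_betw iv (set vs) I" unfolding iv_def by (rule bij_betw_the_inv_into[OF bij])
    ultimately have "bij_betw (iv \<circ> (!) vs) {..<n} I" by (rule bij_betw_trans)
    then show ?thesis by (simp add: o_def)
  qed
  have v_iv: "v (iv (vs ! a)) = vs ! a" if "a < n" for a
    unfolding iv_def using f_the_inv_into_f_bij_betw[OF bij] that by (simp add: n_def)
  have iv_in: "iv (vs ! a) \<in> I" if "a < n" for a
    using bij_betwE[OF bij_iv] that by auto
  have sum_iv: "(\<Sum>a<n. f (iv (vs ! a))) = (\<Sum>p\<in>I. f p)" for f :: "nat \<times> nat \<Rightarrow> complex"
    using sum.reindex_bij_betw[OF bij_iv] .
  define \<omega> where "\<omega> i j = cis (2 * pi * real j / real (l i))" for i j
  define \<phi> where "\<phi> = (\<lambda>(i, j) (i', t). if i' = i then \<omega> i j ^ t else 0)"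
  \<comment> \<open>\<open>\<psi>\<close> is the dual basis of \<open>\<phi>\<close>: on one cycle
    their pairing is a geometric sum over roots of unity, which yields
    \<open>Q * P = 1\<close>.\<close>
  define \<psi> where "\<psi> = (\<lambda>(i, j) (i', t). if i' = i then inverse (\<omega> i j) ^ t / of_nat (l i) else 0)"
  define ev where "ev = (\<lambda>(i, j). - 2 * cos (2 * pi * real j / real (l i)))"
  have l0: "0 < l i" if "i < c" for i using l[OF that] by simp
  have \<omega>1: "\<omega> i j ^ l i = 1" if "i < c" for i j
    unfolding \<omega>_def by (rule cis_root_of_unity[OF l0[OF that]])
  have \<omega>0: "\<omega> i j \<noteq> 0" for i j unfolding \<omega>_def by simp
  have orth: "(\<Sum>p\<in>I. \<psi> q p * \<phi> q' p) = (if q = q' then 1 else 0)" if "q \<in> I" "q' \<in> I" for q q'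
  proof -
    obtain i j i' j' where q: "q = (i, j)" "q' = (i', j')" by (metis surj_pair)
    then have lt: "i < c" "j < l i" "i' < c" "j' < l i'" using that by (auto simp: I_def)
    have "(\<Sum>p\<in>I. \<psi> q p * \<phi> q' p) = (\<Sum>a<c. \<Sum>t<l a. \<psi> q (a, t) * \<phi> q' (a, t))"
      unfolding I_def by (subst sum.Sigma) (auto simp: case_prod_beta')
    also have "\<dots> = (\<Sum>a\<in>{i}. \<Sum>t<l a. \<psi> q (a, t) * \<phi> q' (a, t))"
      using lt by (intro sum.mono_neutral_right) (auto simp: \<psi>_def q)
    also have "\<dots> = (\<Sum>t<l i. \<psi> (i, j) (i, t) * \<phi> (i', j') (i, t))" by (simp add: q)
    also have "\<dots> = (if q = q' then 1 else 0)"
    proof (cases "i = i'")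
      case False
      then show ?thesis by (simp add: \<phi>_def q)
    next
      case True
      let ?z = "\<omega> i j' / \<omega> i j"
      have "(\<Sum>t<l i. \<psi> (i, j) (i, t) * \<phi> (i', j') (i, t)) = (\<Sum>t<l i. ?z ^ t) / of_nat (l i)"
        unfolding sum_divide_distrib using True
        by (intro sum.cong) (auto simp: \<phi>_def \<psi>_def power_divide field_simps)
      also have "(\<Sum>t<l i. ?z ^ t) = (if ?z = 1 then of_nat (l i) else 0)"
        using \<omega>1 lt by (intro sum_powers_root_of_unity) (simp add: power_divide)
      also have "?z = 1 \<longleftrightarrow> j = j'"
        using cis_root_eq_iff[of j "l i" j'] lt True \<omega>0[of i j] by (auto simp: \<omega>_def)
      finally show ?thesis using True q l0[OF lt(1)] by auto
    qed
    finally show ?thesis .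
  qed
  have eig: "(\<Sum>p\<in>I. (if (v r, v p) \<in> R then 1 else 0) * \<phi> q p) = - of_real (ev q) * \<phi> q r"
    if "q \<in> I" "r \<in> I" for q r
  proof -
    obtain i j i' t where q: "q = (i, j)" "r = (i', t)" by (metis surj_pair)
    then have lt: "i < c" "j < l i" "i' < c" "t < l i'" using that by (auto simp: I_def)
    let ?p1 = "(i', (t + 1) mod l i')" and ?p2 = "(i', (t + l i' - 1) mod l i')"
    have p12: "?p1 \<in> I" "?p2 \<in> I" using lt l0 by (auto simp: I_def)
    \<comment> \<open>The successor and the predecessor differ because each cycle has length at
      least 3, so the sum has exactly two terms.\<close>
    have "(t + 1) mod l i' \<noteq> (t + l i' - 1) mod l i'"
    proof (cases t)
      case 0
      then show ?thesis using l[OF lt(3)] by simp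
    next
      case (Suc t')
      then have "(t + l i' - 1) mod l i' = t'" using lt by simp
      then show ?thesis using Suc lt l[OF lt(3)] by (cases "t + 1 = l i'") auto
    qed
    then have ne: "?p1 \<noteq> ?p2" by simp
    have Rp: "(v r, v p) \<in> R \<longleftrightarrow> p = ?p1 \<or> p = ?p2" if "p \<in> I" for p
      unfolding q R[OF lt(3,4)] using inj_on_eq_iff[OF bij_betw_imp_inj_on[OF bij]] that p12 by metis
    have "(\<Sum>p\<in>I. (if (v r, v p) \<in> R then 1 else 0) * \<phi> q p) = (\<Sum>p\<in>{?p1, ?p2}. \<phi> q p)"
      using Rp p12 fin by (intro sum.mono_neutral_cong_right) auto
    also have "\<dots> = \<phi> q ?p1 + \<phi> q ?p2" using ne by simp
    also have "\<dots> = - of_real (ev q) * \<phi> q r"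
    proof (cases "i' = i")
      case False
      then show ?thesis by (simp add: \<phi>_def q)
    next
      case True
      let ?w = "\<omega> i j"
      have w1: "?w ^ l i = 1" using \<omega>1 lt by simp
      \<comment> \<open>The predecessor has position \<open>t + (l i - 1)\<close> modulo
        \<open>l i\<close>, so the inverse of \<open>?w\<close> has to appear as the power
        \<open>l i - 1\<close>.\<close>
      have "?w ^ (l i - 1) * ?w = 1" using w1 l0[OF lt(1)] by (simp add: power_eq_if[of ?w "l i"] mult.commute)
      then have inv: "?w ^ (l i - 1) = inverse ?w" using \<omega>0 by (simp add: field_simps)
      have "t + l i - 1 = t + (l i - 1)" using l0[OF lt(1)] by simp
      then have "\<phi> q ?p1 + \<phi> q ?p2 = ?w ^ t * (?w + inverse ?w)"
        using True w1 by (simp add: \<phi>_def q power_mod_root_of_unity power_add inv[unfolded One_nat_def] algebra_simps)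
      also have "?w + inverse ?w = of_real (2 * cos (2 * pi * real j / real (l i)))"
        by (simp add: \<omega>_def complex_eq_iff)
      finally show ?thesis using True by (simp add: \<phi>_def q ev_def)
    qed
    finally show ?thesis .
  qed
  define P where "P = mat n n (\<lambda>(a, q). \<phi> (qs ! q) (iv (vs ! a)))"
  define Q where "Q = mat n n (\<lambda>(q, a). \<psi> (qs ! q) (iv (vs ! a)))"
  define D where "D = mat n n (\<lambda>(q, q'). if q = q' then complex_of_real (ev (qs ! q)) else 0)"
  let ?M = "map_mat complex_of_real (- E)"
  have cE: "- E \<in> carrier_mat n n" unfolding E n_def by simp
  have c: "P \<in> carrier_mat n n" "Q \<in> carrier_mat n n" "D \<in> carrier_mat n n" "?M \<in> carrier_mat n n"
    using cE by (auto simp: P_def Q_def D_def)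
  have qI: "qs ! q \<in> I" if "q < n" for q using qs(1) len that nth_mem by blast
  have QP: "Q * P = 1\<^sub>m n"
  proof (rule eq_matI)
    fix q q' assume "q < dim_row (1\<^sub>m n)" "q' < dim_col (1\<^sub>m n)"
    then have lt: "q < n" "q' < n" by auto
    have "(Q * P) $$ (q, q') = (\<Sum>a<n. Q $$ (q, a) * P $$ (a, q'))"
      by (rule index_mult_mat_sum[OF c(2,1) lt])
    also have "\<dots> = (\<Sum>a<n. \<psi> (qs ! q) (iv (vs ! a)) * \<phi> (qs ! q') (iv (vs ! a)))"
      using lt by (intro sum.cong) (auto simp: P_def Q_def)
    also have "\<dots> = (\<Sum>p\<in>I. \<psi> (qs ! q) p * \<phi> (qs ! q') p)" by (rule sum_iv)
    also have "\<dots> = (if qs ! q = qs ! q' then 1 else 0)" using orth qI lt by simp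
    finally show "(Q * P) $$ (q, q') = 1\<^sub>m n $$ (q, q')"
      using lt qs(2) len by (simp add: nth_eq_iff_index_eq del: index_mult_mat(1))
  qed (use c in auto)
  have PQ: "P * Q = 1\<^sub>m n" by (rule mat_mult_left_right_inverse[OF c(2,1) QP])
  have MP: "?M * P = P * D"
  proof (rule eq_matI)
    fix a q assume "a < dim_row (P * D)" "q < dim_col (P * D)"
    then have lt: "a < n" "q < n" using c by auto
    have "(?M * P) $$ (a, q) = (\<Sum>b<n. ?M $$ (a, b) * P $$ (b, q))"
      by (rule index_mult_mat_sum[OF c(4,1) lt])
    also have "\<dots> = (\<Sum>b<n. - ((if (v (iv (vs ! a)), v (iv (vs ! b))) \<in> R then 1 else 0) *
        \<phi> (qs ! q) (iv (vs ! b))))"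
      using lt v_iv by (intro sum.cong) (auto simp: P_def E n_def)
    also have "\<dots> = - (\<Sum>p\<in>I. (if (v (iv (vs ! a)), v p) \<in> R then 1 else 0) * \<phi> (qs ! q) p)"
      unfolding sum_negf sum_iv[of "\<lambda>p. (if (v (iv (vs ! a)), v p) \<in> R then 1 else 0) * \<phi> (qs ! q) p"] ..
    also have "\<dots> = \<phi> (qs ! q) (iv (vs ! a)) * of_real (ev (qs ! q))"
      using eig qI iv_in lt by simp
    finally have 1: "(?M * P) $$ (a, q) = \<phi> (qs ! q) (iv (vs ! a)) * of_real (ev (qs ! q))" .
    have "(P * D) $$ (a, q) = (\<Sum>b<n. P $$ (a, b) * D $$ (b, q))"
      by (rule index_mult_mat_sum[OF c(1,3) lt])
    also have "\<dots> = (\<Sum>b<n. if b = q then P $$ (a, b) * of_real (ev (qs ! b)) else 0)"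
      using lt by (intro sum.cong) (auto simp: D_def)
    also have "\<dots> = \<phi> (qs ! q) (iv (vs ! a)) * of_real (ev (qs ! q))" using lt by (simp add: P_def)
    finally show "(?M * P) $$ (a, q) = (P * D) $$ (a, q)" using 1 by simp
  qed (use c in auto)
  have "?M = ?M * (P * Q)" using c PQ by simp
  also have "\<dots> = P * D * Q" using assoc_mult_mat[OF c(4,1,2)] MP by simp
  finally have "similar_mat ?M D" using c PQ QP by (intro similar_matI[of _ _ P Q n]) auto
  then have "char_poly ?M = char_poly D" by (rule char_poly_similar)
  also have "\<dots> = (\<Prod>a\<leftarrow>diag_mat D. [:- a, 1:])"
    by (rule char_poly_upper_triangular[OF c(3)]) (auto simp: D_def upper_triangular_def)
  also have "diag_mat D = map (\<lambda>q. of_real (ev q)) qs"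
    using len by (intro nth_equalityI) (auto simp: diag_mat_def D_def)
  finally have "char_poly ?M = map_poly complex_of_real (\<Prod>q\<leftarrow>qs. [:- ev q, 1:])"
    by (simp add: of_real_poly.hom_prod_list o_def)
  \<comment> \<open>The diagonalisation is complex but its eigenvalues are real, so the
    factorization descends to real polynomials.\<close>
  then have "map_poly complex_of_real (char_poly (- E)) = map_poly complex_of_real (\<Prod>q\<leftarrow>qs. [:- ev q, 1:])"
    using of_real_hom.char_poly_hom[OF cE, where ?'a = complex] by simp
  then have "char_poly (- E) = (\<Prod>q\<leftarrow>qs. [:- ev q, 1:])" by (rule of_real_poly.injectivity)
  also have "\<dots> = (\<Prod>q\<in>I. [:- ev q, 1:])" using prod.distinct_set_conv_list[OF qs(2)] qs(1) by metis
  also have "\<dots> = (\<Prod>(i, j)\<in>I. [:2 * cos (2 * pi * real j / real (l i)), 1:])"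
    by (intro prod.cong) (auto simp: ev_def)
  finally show ?thesis .
qed

text \<open>Used with \<open>h = H_{d-1}\<close> to pass from the known values \<open>h x\<close>
  back to the eigenvalues \<open>x\<close>: one preimage is removed for each index in
  \<open>P\<close> and recorded as \<open>y\<close>, and the remaining elements \<open>S\<close> are
  mapped to \<open>a\<close>.\<close>

lemma image_mset_split:
  assumes "finite P" "image_mset h M = replicate_mset m a + image_mset \<phi> (mset_set P)"
  shows "\<exists>S y. M = S + image_mset y (mset_set P) \<and> size S = m \<and> (\<forall>x\<in>#S. h x = a) \<and> (\<forall>q\<in>P. h (y q) = \<phi> q)"
  using assms
proof (induction P arbitrary: M rule: finite_induct)
  case empty
  have "size M = m" using empty by (metis add.right_neutral image_mset_empty mset_set.empty size_image_mset
        size_replicate_mset)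
  moreover have "h x = a" if "x \<in># M" for x
  proof -
    have "h x \<in># replicate_mset m a" using that empty
      by (metis add.right_neutral image_mset_empty mset_set.empty imageI set_image_mset)
    then show ?thesis by (simp split: if_splits)
  qed
  ultimately show ?case by auto
next
  case (insert p P)
  have "image_mset h M = add_mset (\<phi> p) (replicate_mset m a + image_mset \<phi> (mset_set P))"
    using insert by simp
  then obtain x M' where x: "M = add_mset x M'" "h x = \<phi> p"
      "image_mset h M' = replicate_mset m a + image_mset \<phi> (mset_set P)"
    by (metis msed_map_invR)
  from insert.IH[OF x(3)] obtain S y where S: "M' = S + image_mset y (mset_set P)" "size S = m"
    "\<forall>x\<in>#S. h x = a" "\<forall>q\<in>P. h (y q) = \<phi> q" by blast
  have "image_mset (y(p := x)) (mset_set P) = image_mset y (mset_set P)"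
    using insert.hyps by (intro image_mset_cong) auto
  then have "M = S + image_mset (y(p := x)) (mset_set (insert p P))" using x S insert.hyps by simp
  moreover have "\<forall>q\<in>insert p P. h ((y(p := x)) q) = \<phi> q" using S x insert.hyps by auto
  ultimately show ?case using S by blast
qed

section \<open>The spectrum of the adjacency matrix\<close>

lemma poly_H_poly_uminus: "poly (H_poly k i) (- x) = (- 1) ^ i * poly (H_poly k i) x"
  by (induction i rule: induct_nat_012) (auto simp: algebra_simps)

lemma poly_H_poly_degree: "poly (H_poly k i) (real k) = (\<Sum>j<Suc i. (real k - 1) ^ j)"
  by (induction i rule: induct_nat_012) (auto simp: algebra_simps)

section \<open>Root multisets of characteristic polynomials\<close>

lemma proots_mult_linear:
  fixes p :: "'a :: idom poly"
  assumes "p \<noteq> 0"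
  shows "proots (p * [:- a, 1:]) = add_mset a (proots p)"
  using assms by (subst proots_mult) auto

lemma proots_prod_linear:
  fixes f :: "'b \<Rightarrow> 'a :: idom"
  assumes "finite I"
  shows "proots (\<Prod>i\<in>I. [:- f i, 1:]) = image_mset f (mset_set I)"
  using assms
proof (induction I rule: finite_induct)
  case (insert i I)
  have "(\<Prod>i\<in>I. [:- f i, 1:]) \<noteq> 0" using insert.hyps by simp
  then show ?case using insert proots_mult_linear[of "\<Prod>i\<in>I. [:- f i, 1:]" "f i"]
    by (simp add: mult.commute del: mult_pCons_left mult_pCons_right)
qed simp

lemma proots_prod_list_linear:
  fixes f :: "'b \<Rightarrow> 'a :: idom"
  shows "proots (\<Prod>r\<leftarrow>rs. [:- f r, 1:]) = image_mset f (mset rs)"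
proof (induction rs)
  case (Cons r rs)
  have "(\<Prod>r\<leftarrow>rs. [:- f r, 1:]) \<noteq> 0" by (auto simp: prod_list_zero_iff)
  then show ?case using Cons proots_mult_linear[of "\<Prod>r\<leftarrow>rs. [:- f r, 1:]" "f r"]
    by (simp add: mult.commute del: mult_pCons_left mult_pCons_right)
qed simp

lemma char_poly_nonzero: "A \<in> carrier_mat n n \<Longrightarrow> char_poly A \<noteq> (0 :: 'a :: field poly)"
  using degree_monic_char_poly[of A n] by auto

lemma eigenvalue_in_proots:
  fixes A :: "'a :: field mat"
  assumes A: "A \<in> carrier_mat n n" and "0 < n" and nz: "\<And>i. i < n \<Longrightarrow> f i \<noteq> 0"
    and ev: "\<And>i. i < n \<Longrightarrow> (\<Sum>j<n. A $$ (i, j) * f j) = \<mu> * f i"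
  shows "\<mu> \<in># proots (char_poly A)"
proof -
  have "A *\<^sub>v vec n f = \<mu> \<cdot>\<^sub>v vec n f"
    using A ev by (intro eq_vecI) (auto simp: scalar_prod_def atLeast0LessThan)
  moreover have "vec n f \<noteq> 0\<^sub>v n"
  proof
    assume "vec n f = 0\<^sub>v n"
    then have "vec n f $ 0 = 0\<^sub>v n $ 0" by simp
    then show False using nz[of 0] \<open>0 < n\<close> by simp
  qed
  ultimately have "eigenvalue A \<mu>" using A unfolding eigenvalue_def eigenvector_def by (intro exI[of _ "vec n f"]) auto
  then show ?thesis using eigenvalue_root_char_poly[OF A] char_poly_nonzero[OF A]
    by (simp add: set_count_proots)
qed

section \<open>Relation between the spectra of the adjacency and the excess matrix\<close>

context small_excess_graph
begin

lemma V_nonempty: "V \<noteq> {}"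
  using card_V by auto

context
  fixes vs :: "'a list" and w0 :: 'a
  assumes vs: "distinct vs" "set vs = V" and w0: "w0 \<in> V"
begin

definition Adj :: "real mat" where
  "Adj = mat (length vs) (length vs) (\<lambda>(i, j). if adj (vs ! i) (vs ! j) then 1 else 0)"

definition Exc :: "real mat" where
  "Exc = mat (length vs) (length vs) (\<lambda>(i, j). if dst (vs ! i) (vs ! j) = d + 1 then 1 else 0)"

definition side :: "'a \<Rightarrow> real" where "side x = (if even (dst w0 x) then 1 else - 1)"

text \<open>The sign \<open>(-1)^(d-1)\<close>, which is also the product of the sides of two
  vertices at distance \<open>d + 1\<close>.\<close>

definition \<epsilon> :: real where "\<epsilon> = (if odd d then 1 else - 1)"

lemma vs_in [simp]: "i < length vs \<Longrightarrow> vs ! i \<in> V"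
  using vs by auto

lemma sum_vs: "(\<Sum>i<length vs. f (vs ! i)) = (\<Sum>x\<in>V. f x)" for f :: "'a \<Rightarrow> real"
  using sum.reindex_bij_betw[OF bij_betw_nth[OF vs(1) refl refl]] vs by simp

lemma Adj_carrier: "Adj \<in> carrier_mat (length vs) (length vs)"
  and Exc_carrier: "Exc \<in> carrier_mat (length vs) (length vs)"
  by (auto simp: Adj_def Exc_def)

text \<open>Multiplication by \<open>Adj\<close> sums over the neighbours of the column vertex, so
  \<open>ball_ind_rec\<close> is the recurrence of \<open>H_mat\<close>.\<close>

lemma H_mat_Adj:
  assumes "i < d"
  shows "H_mat k Adj i = mat (length vs) (length vs) (\<lambda>(a, b). ball_ind i (vs ! a) (vs ! b))"
  using assms
proof (induction i rule: induct_nat_012)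
  case 0
  show ?case using vs by (intro eq_matI) (auto simp: ball_ind_0 nth_eq_iff_index_eq Adj_def)
next
  case 1
  show ?case by (intro eq_matI) (auto simp: ball_ind_1 Adj_def)
next
  case (ge2 i)
  let ?n = "length vs"
  let ?B = "\<lambda>i. mat ?n ?n (\<lambda>(a, b). ball_ind i (vs ! a) (vs ! b))"
  have IH: "H_mat k Adj i = ?B i" "H_mat k Adj (Suc i) = ?B (Suc i)" using ge2 by auto
  show ?case
  proof (rule eq_matI)
    fix a b assume "a < dim_row (?B (Suc (Suc i)))" "b < dim_col (?B (Suc (Suc i)))"
    then have ab: "a < ?n" "b < ?n" by auto
    have "(?B (Suc i) * Adj) $$ (a, b) = (\<Sum>e<?n. ?B (Suc i) $$ (a, e) * Adj $$ (e, b))"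
      using ab by (intro index_mult_mat_sum[OF _ Adj_carrier]) auto
    also have "\<dots> = (\<Sum>e<?n. if adj (vs ! b) (vs ! e) then ball_ind (Suc i) (vs ! a) (vs ! e) else 0)"
      using ab by (intro sum.cong) (auto simp: Adj_def dest: adj_sym)
    also have "\<dots> = (\<Sum>y\<in>V. if adj (vs ! b) y then ball_ind (Suc i) (vs ! a) y else 0)"
      by (rule sum_vs)
    also have "\<dots> = (\<Sum>y\<in>{y. adj (vs ! b) y}. ball_ind (Suc i) (vs ! a) y)"
      using finite_V adj_V2 by (intro sum.mono_neutral_cong_right) auto
    also have "\<dots> = ball_ind (Suc (Suc i)) (vs ! a) (vs ! b) + (real k - 1) * ball_ind i (vs ! a) (vs ! b)"
      using ball_ind_rec[of "vs ! b" "Suc i" "vs ! a"] ge2.prems ab by simp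
    finally show "H_mat k Adj (Suc (Suc i)) $$ (a, b) = ?B (Suc (Suc i)) $$ (a, b)"
      using ab Adj_carrier by (simp add: IH del: index_mult_mat(1))
  qed (use Adj_carrier in \<open>simp_all add: IH\<close>)
qed

lemma side_mult:
  assumes "x \<in> V" "y \<in> V"
  shows "side x * side y = (if even (dst x y) then 1 else - 1)"
  using dst_parity[OF w0 assms] by (auto simp: side_def)

lemma side_square: "side x * side x = 1"
  by (simp add: side_def)

lemma side_adj: "adj x y \<Longrightarrow> side y = - side x"
  using side_mult[of x y] dst_eq_1[of x y] adj_V[of x y] adj_V2[of x y]
  by (auto simp: side_def split: if_splits)

lemma sum_side: "(\<Sum>x\<in>V. side x) = 0"
proof -
  have "(\<Sum>x\<in>V. side x) = real (card {x\<in>V. even (dst w0 x)}) - real (card {x\<in>V. odd (dst w0 x)})"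
  proof -
    have "(\<Sum>x\<in>V. side x) = (\<Sum>x\<in>V. (if even (dst w0 x) then 1 else 0) - (if odd (dst w0 x) then 1 else 0))"
      by (intro sum.cong) (auto simp: side_def)
    then show ?thesis using finite_V by (simp add: sum_subtractf flip: sum.inter_filter)
  qed
  then show ?thesis using card_side[OF w0] by simp
qed

lemma card_V_half: "real (length vs) / 2 = real half_moore + 2"
proof -
  have "length vs = 2 * half_moore + 4"
    using card_V distinct_card[OF vs(1)] vs(2) by (simp add: moore_bound_even_def half_moore_def)
  then show ?thesis by simp
qed

text \<open>The last two summands together indicate that the distance has the parity of
  \<open>d - 1\<close>. Since it is at most \<open>d + 1\<close>, it is then at most
  \<open>d - 1\<close> or exactly \<open>d + 1\<close>, and the first summand removes the latter
  case. The bracketing is that of \<open>char_poly_rank_one_update\<close>.\<close>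

lemma ball_ind_decomposition:
  assumes "x \<in> V" "y \<in> V"
  shows "ball_ind (d - 1) x y = - (if dst x y = d + 1 then 1 else 0) + 1 / 2 + side x * (\<epsilon> / 2 * side y)"
proof -
  have "side x * (\<epsilon> / 2 * side y) = (if odd (dst x y + d) then 1 / 2 else - 1 / 2)"
    using side_mult[OF assms] by (auto simp: \<epsilon>_def)
  moreover have "ball_ind (d - 1) x y = (if dst x y \<le> d - 1 \<and> odd (dst x y + d) then 1 else 0)"
    using d_ge by (simp add: ball_ind_def)
  moreover have "dst x y \<le> d + 1" using diameter_le assms by blast
  moreover have "dst x y \<le> d - 1 \<or> dst x y = d + 1" if "odd (dst x y + d)"
  proof -
    have "dst x y \<noteq> d" using that by auto
    then show ?thesis using \<open>dst x y \<le> d + 1\<close> by linarith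
  qed
  ultimately show ?thesis using d_ge by (auto split: if_splits)
qed

lemma sum_antipodes:
  assumes "x \<in> V"
  shows "(\<Sum>y\<in>V. if dst x y = d + 1 then 1 else 0) = (2 :: real)"
  using card_antipodes[OF assms] finite_V by (simp flip: sum.inter_filter)

lemma sum_antipodes_side:
  assumes "x \<in> V"
  shows "(\<Sum>y\<in>V. (if dst x y = d + 1 then 1 else 0) * side y) = 2 * \<epsilon> * side x"
proof -
  have "(if dst x y = d + 1 then 1 else 0) * side y = \<epsilon> * side x * (if dst x y = d + 1 then 1 else 0)"
    if "y \<in> V" for y
  proof (cases "dst x y = d + 1")
    case True
    then have "side x * side y = \<epsilon>" using side_mult[OF assms that] by (simp add: \<epsilon>_def)
    then show ?thesis using True side_square[of x] by (metis mult.assoc mult.commute mult_1)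
  qed simp
  then have "(\<Sum>y\<in>V. (if dst x y = d + 1 then 1 else 0) * side y) =
      (\<Sum>y\<in>V. \<epsilon> * side x * (if dst x y = d + 1 then 1 else 0))" by (intro sum.cong) auto
  then show ?thesis using sum_antipodes[OF assms] by (simp flip: sum_distrib_left)
qed

text \<open>\<open>T\<close> holds the eigenvalues of \<open>Adj\<close> other than one copy each of
  \<open>k\<close> and \<open>-k\<close>. Two rank one updates lead from \<open>- Exc\<close> to
  \<open>H_{d-1}(Adj)\<close>; they exchange \<open>-2\<close> for \<open>H_{d-1}(k)\<close> and
  \<open>-2 \<epsilon>\<close> for \<open>H_{d-1}(-k)\<close>.\<close>

lemma spectrum_relation:
  "\<exists>T. proots (char_poly Adj) = {#real k, - real k#} + T \<and>
     image_mset (poly (H_poly k (d - 1))) T + {#- 2, - 2 * \<epsilon>#} = proots (char_poly (- Exc))"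
proof -
  let ?n = "length vs"
  let ?h = "real half_moore"
  have n0: "0 < ?n" using vs V_nonempty by auto
  obtain rs where rs: "char_poly Adj = (\<Prod>r\<leftarrow>rs. [:- r, 1:])"
    by (rule symmetric_char_poly_splits[OF Adj_carrier]) (auto simp: Adj_def adj_commute)
  have proots_A: "proots (char_poly Adj) = mset rs" using rs proots_prod_list_linear[of "\<lambda>r. r" rs] by simp
  have "real k \<in># proots (char_poly Adj)"
  proof (rule eigenvalue_in_proots[OF Adj_carrier n0, of "\<lambda>_. 1"])
    fix i assume i: "i < ?n"
    have "(\<Sum>j<?n. Adj $$ (i, j) * 1) = (\<Sum>j<?n. if adj (vs ! i) (vs ! j) then 1 else 0)"
      using i by (intro sum.cong) (auto simp: Adj_def)
    also have "\<dots> = (\<Sum>y\<in>V. if adj (vs ! i) y then 1 else 0)" by (rule sum_vs)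
    also have "\<dots> = (\<Sum>y\<in>{y. adj (vs ! i) y}. 1)"
      using finite_V adj_V2 by (intro sum.mono_neutral_cong_right) auto
    finally show "(\<Sum>j<?n. Adj $$ (i, j) * 1) = real k * 1" using regular[of "vs ! i"] i by simp
  qed simp
  moreover have "- real k \<in># proots (char_poly Adj)"
  proof (rule eigenvalue_in_proots[OF Adj_carrier n0, of "\<lambda>i. side (vs ! i)"])
    fix i assume i: "i < ?n"
    have "(\<Sum>j<?n. Adj $$ (i, j) * side (vs ! j)) = (\<Sum>j<?n. if adj (vs ! i) (vs ! j) then side (vs ! j) else 0)"
      using i by (intro sum.cong) (auto simp: Adj_def)
    also have "\<dots> = (\<Sum>y\<in>V. if adj (vs ! i) y then side y else 0)" by (rule sum_vs)
    also have "\<dots> = (\<Sum>y\<in>{y. adj (vs ! i) y}. - side (vs ! i))"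
      using finite_V adj_V2 side_adj by (intro sum.mono_neutral_cong_right) auto
    finally show "(\<Sum>j<?n. Adj $$ (i, j) * side (vs ! j)) = - real k * side (vs ! i)"
      using regular[of "vs ! i"] i by simp
  qed (simp add: side_def)
  moreover have "real k \<noteq> - real k" using k_ge by simp
  ultimately have mem: "real k \<in># mset rs" "- real k \<in># mset rs" "- real k \<noteq> real k"
    unfolding proots_A by auto
  obtain T' where T': "mset rs = add_mset (real k) T'" using multi_member_split[OF mem(1)] by blast
  then have "- real k \<in># T'" using mem(2,3) by simp
  then obtain T where "T' = add_mset (- real k) T" by (blast dest: multi_member_split)
  with T' have T: "mset rs = {#real k, - real k#} + T" by simp
  let ?H = "poly (H_poly k (d - 1))"
  let ?B = "H_mat k Adj (d - 1)"
  have Hk: "?H (real k) = ?h"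
    unfolding poly_H_poly_degree half_moore_def using d_ge k_ge by (simp add: of_nat_diff)
  have Hmk: "?H (- real k) = \<epsilon> * ?h"
    unfolding poly_H_poly_uminus Hk using d_ge by (simp add: \<epsilon>_def)
  have B1: "proots (char_poly ?B) = image_mset ?H T + {#?h, \<epsilon> * ?h#}"
    unfolding char_poly_H_mat[OF Adj_carrier rs] proots_prod_list_linear T using Hk Hmk by (simp add: add_mset_commute del: One_nat_def)
  \<comment> \<open>The first update adds 1/2 to every entry. The rows of \<open>- Exc\<close> sum
    to \<open>-2\<close>, and half the number of vertices is \<open>half_moore + 2\<close>, so
    \<open>-2\<close> is exchanged for \<open>half_moore\<close>.\<close>
  define N where "N = mat ?n ?n (\<lambda>(i, j). (- Exc) $$ (i, j) + 1 * (1 / 2))"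
  have cN: "N \<in> carrier_mat ?n ?n" and cE: "- Exc \<in> carrier_mat ?n ?n" using Exc_carrier by (auto simp: N_def)
  have cB: "?B \<in> carrier_mat ?n ?n" by (rule H_mat_carrier[OF Adj_carrier])
  have "char_poly N * [:- (- 2), 1:] = char_poly (- Exc) * [:- (- 2 + (\<Sum>j<?n. 1 / 2 * 1)), 1:]"
    unfolding N_def
  proof (rule char_poly_rank_one_update[OF cE])
    fix i assume i: "i < ?n"
    have "(\<Sum>j<?n. (- Exc) $$ (i, j) * 1) = (\<Sum>j<?n. - (if dst (vs ! i) (vs ! j) = d + 1 then 1 else 0))"
      using i by (intro sum.cong) (auto simp: Exc_def)
    also have "\<dots> = - 2" unfolding sum_vs[of "\<lambda>y. - (if dst (vs ! i) y = d + 1 then 1 else 0)"]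
      using sum_antipodes[of "vs ! i"] i by (simp add: sum_negf)
    finally show "(\<Sum>j<?n. (- Exc) $$ (i, j) * 1) = - 2 * 1" by simp
  qed
  also have "- 2 + (\<Sum>j<?n. 1 / 2 * 1) = ?h" using card_V_half by (simp add: field_simps)
  finally have 1: "add_mset (- 2) (proots (char_poly N)) = add_mset ?h (proots (char_poly (- Exc)))"
    unfolding proots_mult_linear[OF char_poly_nonzero[OF cN], symmetric]
      proots_mult_linear[OF char_poly_nonzero[OF cE], symmetric] by simp
  have B_eq: "?B = mat ?n ?n (\<lambda>(i, j). N $$ (i, j) + side (vs ! i) * (\<epsilon> / 2 * side (vs ! j)))"
  proof -
    have "?B = mat ?n ?n (\<lambda>(a, b). ball_ind (d - 1) (vs ! a) (vs ! b))"
      using H_mat_Adj[of "d - 1"] d_ge by simp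
    also have "\<dots> = mat ?n ?n (\<lambda>(i, j). N $$ (i, j) + side (vs ! i) * (\<epsilon> / 2 * side (vs ! j)))"
      by (rule eq_matI) (simp_all add: N_def Exc_def ball_ind_decomposition del: One_nat_def)
    finally show ?thesis .
  qed
  \<comment> \<open>The sides have equal size, so the constant part of \<open>N\<close> annihilates
    \<open>side\<close>, which therefore remains an eigenvector for \<open>-2 \<epsilon>\<close>
    after the first update.\<close>
  have update: "char_poly (mat ?n ?n (\<lambda>(i, j). N $$ (i, j) + side (vs ! i) * (\<epsilon> / 2 * side (vs ! j)))) *
      [:- (- 2 * \<epsilon>), 1:] =
      char_poly N * [:- (- 2 * \<epsilon> + (\<Sum>j<?n. \<epsilon> / 2 * side (vs ! j) * side (vs ! j))), 1:]"
  proof (rule char_poly_rank_one_update[OF cN])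
    fix i assume i: "i < ?n"
    let ?x = "vs ! i"
    have "(\<Sum>j<?n. N $$ (i, j) * side (vs ! j)) =
      (\<Sum>j<?n. - ((if dst ?x (vs ! j) = d + 1 then 1 else 0) * side (vs ! j)) + 1 / 2 * side (vs ! j))"
      using i by (intro sum.cong) (auto simp: N_def Exc_def algebra_simps)
    also have "\<dots> = (\<Sum>y\<in>V. - ((if dst ?x y = d + 1 then 1 else 0) * side y) + 1 / 2 * side y)"
      by (rule sum_vs)
    also have "\<dots> = - (\<Sum>y\<in>V. (if dst ?x y = d + 1 then 1 else 0) * side y) + 1 / 2 * (\<Sum>y\<in>V. side y)"
      by (simp only: sum.distrib sum_negf sum_distrib_left)
    also have "\<dots> = - 2 * \<epsilon> * side ?x"
      using sum_antipodes_side[of ?x] sum_side i by simp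
    finally show "(\<Sum>j<?n. N $$ (i, j) * side (vs ! j)) = - 2 * \<epsilon> * side ?x" .
  qed
  have shift: "- 2 * \<epsilon> + (\<Sum>j<?n. \<epsilon> / 2 * side (vs ! j) * side (vs ! j)) = \<epsilon> * ?h"
  proof -
    have "(\<Sum>j<?n. \<epsilon> / 2 * side (vs ! j) * side (vs ! j)) = \<epsilon> * (real ?n / 2)"
      using side_square by (simp add: mult.assoc)
    then show ?thesis unfolding card_V_half by (simp add: algebra_simps)
  qed
  have "char_poly ?B * [:- (- 2 * \<epsilon>), 1:] = char_poly N * [:- (\<epsilon> * ?h), 1:]"
    using update unfolding B_eq shift .
  then have 2: "add_mset (- 2 * \<epsilon>) (proots (char_poly ?B)) = add_mset (\<epsilon> * ?h) (proots (char_poly N))"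
    unfolding proots_mult_linear[OF char_poly_nonzero[OF cB], symmetric]
      proots_mult_linear[OF char_poly_nonzero[OF cN], symmetric] by (rule arg_cong)
  \<comment> \<open>Both exchanges are kept in additive form, so that combining them needs only
    cancellation and no multiset difference.\<close>
  have "image_mset ?H T + {#- 2, - 2 * \<epsilon>#} + {#?h, \<epsilon> * ?h#} =
      add_mset (- 2) (add_mset (- 2 * \<epsilon>) (proots (char_poly ?B)))"
    unfolding B1 by simp
  also have "\<dots> = proots (char_poly (- Exc)) + {#?h, \<epsilon> * ?h#}"
    unfolding 2 using 1 by (metis add_mset_commute add_mset_add_single union_mset_add_mset_right)
  finally have "image_mset ?H T + {#- 2, - 2 * \<epsilon>#} = proots (char_poly (- Exc))"
    unfolding add_right_cancel .
  then show ?thesis using proots_A T by auto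
qed

end

lemma antipodal_two_regular:
  defines "R \<equiv> {(u, v). u \<in> V \<and> v \<in> V \<and> dst u v = d + 1}"
  shows "R \<subseteq> V \<times> V" "sym R" "irrefl R" "v \<in> V \<Longrightarrow> card {u. (v, u) \<in> R} = 2"
proof -
  show "R \<subseteq> V \<times> V" "irrefl R" by (auto simp: R_def irrefl_def)
  show "sym R" using dst_sym by (auto simp: R_def sym_def)
  assume "v \<in> V"
  then show "card {u. (v, u) \<in> R} = 2" using card_antipodes[of v] by (simp add: R_def)
qed

end

section \<open>The eigenvalue \<open>-2\<close> among those of the cycles\<close>

lemma cos_root_ne_1:
  assumes "0 < j" "j < l"
  shows "cos (2 * pi * real j / real l) \<noteq> 1"
proof
  assume "cos (2 * pi * real j / real l) = 1"
  then obtain m :: int where "2 * pi * real j / real l = of_int m * 2 * pi"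
    unfolding cos_one_2pi_int by auto
  then have "real j = of_int m * real l" using assms by (simp add: field_simps)
  then have m: "int j = m * int l" by (metis of_int_eq_iff of_int_mult of_int_of_nat_eq)
  then have "0 < m" using assms by (metis of_nat_0_less_iff zero_less_mult_pos2 less_trans)
  then have "1 * int l \<le> m * int l" by (intro mult_right_mono) auto
  then show False using m assms by linarith
qed

text \<open>The index \<open>j = 0\<close> contributes \<open>-2\<close> once for each
  cycle.\<close>

lemma mset_cycle_eigenvalues:
  fixes c :: nat and l :: "nat \<Rightarrow> nat"
  assumes "\<And>i. i < c \<Longrightarrow> 3 \<le> l i"
  defines "\<phi> \<equiv> \<lambda>(i, j). - 2 * cos (2 * pi * real j / real (l i))"
  shows "image_mset \<phi> (mset_set (SIGMA i:{..<c}. {..<l i})) =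
     replicate_mset c (- 2) + image_mset \<phi> (mset_set (SIGMA i:{..<c}. {1..l i - 1}))"
proof -
  let ?Z = "(\<lambda>i. (i, 0 :: nat)) ` {..<c}" and ?P = "SIGMA i:{..<c}. {1..l i - 1}"
  have eq: "(SIGMA i:{..<c}. {..<l i}) = ?Z \<union> ?P"
  proof (intro equalityI subsetI)
    fix q assume "q \<in> (SIGMA i:{..<c}. {..<l i})"
    then show "q \<in> ?Z \<union> ?P" by (cases "snd q") auto
  qed (use assms(1) in force)
  have "mset_set (?Z \<union> ?P) = mset_set ?Z + mset_set ?P" by (intro mset_set_Union) auto
  moreover have "image_mset \<phi> (mset_set ?Z) = replicate_mset c (- 2)"
  proof -
    have "mset_set ?Z = image_mset (\<lambda>i. (i, 0)) (mset_set {..<c})"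
      by (rule image_mset_mset_set[symmetric]) (auto simp: inj_on_def)
    then have "image_mset \<phi> (mset_set ?Z) = image_mset (\<lambda>_. - 2) (mset_set {..<c})"
      by (simp only: image_mset.compositionality) (simp add: o_def \<phi>_def)
    then show ?thesis by (simp add: image_mset_const_eq)
  qed
  ultimately show ?thesis unfolding eq by simp
qed

section \<open>Walks, cycles and distances in terms of arcs\<close>

lemma bipartition_walk:
  assumes "bipartition G V1 V2" "((\<lambda>u v. (u, v) \<in> parcs G) ^^ m) u v"
  shows "(v \<in> V1 \<longleftrightarrow> u \<in> V1) \<longleftrightarrow> even m"
  using assms(2)
proof (induction m arbitrary: v)
  case (Suc m)
  then obtain x where "((\<lambda>u v. (u, v) \<in> parcs G) ^^ m) u x" "(x, v) \<in> parcs G" by auto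
  then show ?case using Suc.IH[of x] assms(1) unfolding bipartition_def by auto
qed auto

text \<open>Converts a path given by vertices into a walk given by arcs; with
  \<open>z = hd xs\<close> the walk is closed, which is the case needed for the girth.\<close>

lemma pawalk_of_vertices:
  assumes "xs \<noteq> []" "successively (\<lambda>u v. (u, v) \<in> E) xs" "(last xs, z) \<in> E"
  shows "set (zip xs (tl xs @ [z])) \<subseteq> E" "pcas (hd xs) (zip xs (tl xs @ [z])) z"
    "pawalk_verts (hd xs) (zip xs (tl xs @ [z])) = xs @ [z]"
  using assms
proof (induction xs)
  case (Cons x xs)
  { case 1 show ?case using Cons 1 by (cases xs) auto }
  { case 2 show ?case using Cons 2 by (cases xs) auto }
  { case 3 show ?case using Cons 3 by (cases xs) auto }
qed auto

lemma girth_le_cycle: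
  assumes "pair_graph G" "3 \<le> length xs" "distinct xs"
    and "successively (\<lambda>u v. (u, v) \<in> parcs G) xs" "(last xs, hd xs) \<in> parcs G"
  shows "girth G \<le> enat (length xs)"
proof -
  interpret pair_graph G by fact
  have ne: "xs \<noteq> []" using assms by auto
  define p where "p = zip xs (tl xs @ [hd xs])"
  note w = pawalk_of_vertices[OF ne assms(4,5), folded p_def]
  have len: "length p = length xs" using ne by (simp add: p_def)
  have "hd xs \<in> pverts G" using assms(5) in_arcsD2 by blast
  then have "awalk (hd xs) p (hd xs)" using w by (simp add: awalk_def)
  moreover have "distinct (tl (pawalk_verts (hd xs) p))"
    unfolding w(3) using ne assms(3) by (cases xs) auto
  moreover have "p \<noteq> []" using len ne by auto
  ultimately have "cycle p" unfolding cycle_def by auto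
  then show ?thesis unfolding girth_def using len assms(2) by (intro INF_lower2[of p]) auto
qed

lemma awalk_iff_relpowp:
  assumes "pair_graph G" "u \<in> pverts G"
  shows "(\<exists>p. pre_digraph.awalk (with_proj G) u p v \<and> length p = m) \<longleftrightarrow>
    ((\<lambda>u v. (u, v) \<in> parcs G) ^^ m) u v"
  using assms(2)
proof (induction m arbitrary: u)
  case 0
  interpret pair_graph G by fact
  show ?case using 0 by (auto simp: awalk_def)
next
  case (Suc m)
  interpret pair_graph G by fact
  show ?case
  proof
    assume "\<exists>p. awalk u p v \<and> length p = Suc m"
    then obtain e p where p: "awalk u (e # p) v" "length p = m" by (auto simp: length_Suc_conv)
    then have e: "e \<in> parcs G" "fst e = u" "awalk (snd e) p v" by (auto simp: awalk_Cons_iff)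
    have "snd e \<in> pverts G" using arc_snd_in_verts[OF e(1)] .
    then have "((\<lambda>u v. (u, v) \<in> parcs G) ^^ m) (snd e) v" using Suc.IH[of "snd e"] e p by auto
    moreover have "(u, snd e) \<in> parcs G" using e by (cases e) auto
    ultimately show "((\<lambda>u v. (u, v) \<in> parcs G) ^^ Suc m) u v" by (metis relpowp_Suc_I2)
  next
    assume *: "((\<lambda>u v. (u, v) \<in> parcs G) ^^ Suc m) u v"
    obtain y where y: "(u, y) \<in> parcs G" "((\<lambda>u v. (u, v) \<in> parcs G) ^^ m) y v"
      using relpowp_Suc_E2[OF *] .
    then obtain p where "awalk y p v" "length p = m" using Suc.IH[of y] in_arcsD2 by blast
    then show "\<exists>p. awalk u p v \<and> length p = Suc m"
      using y Suc.prems by (intro exI[of _ "(u, y) # p"]) (auto simp: awalk_Cons_iff)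
  qed
qed

text \<open>With unit costs the cost of a walk is its length, so the infimum defining
  \<open>gdist\<close> is attained by a shortest walk.\<close>

lemma gdist_eqI:
  assumes G: "pair_graph G" "u \<in> pverts G"
    and walk: "((\<lambda>u v. (u, v) \<in> parcs G) ^^ m) u v"
    and min: "\<And>m'. ((\<lambda>u v. (u, v) \<in> parcs G) ^^ m') u v \<Longrightarrow> m \<le> m'"
  shows "gdist G u v = ereal (real m)"
proof -
  interpret pair_graph G by fact
  have cost: "awalk_cost (\<lambda>_. 1) p = real (length p)" for p by (induction p) auto
  have "gdist G u v = (INF p\<in>{p. awalk u p v}. ereal (real (length p)))"
    unfolding gdist_def \<mu>_def cost ..
  also have "\<dots> = ereal (real m)"
  proof (rule antisym)
    obtain p where "awalk u p v" "length p = m" using awalk_iff_relpowp[OF G] walk by blast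
    then show "(INF p\<in>{p. awalk u p v}. ereal (real (length p))) \<le> ereal (real m)"
      by (intro INF_lower2[of p]) auto
    show "ereal (real m) \<le> (INF p\<in>{p. awalk u p v}. ereal (real (length p)))"
      using awalk_iff_relpowp[OF G] min by (intro INF_greatest) auto
  qed
  finally show ?thesis .
qed

lemma kg_graph_imp_small_excess_graph:
  assumes "k \<ge> 6" "g = 2 * d" "g \<ge> 6" "kg_graph k g G" "excess k d G = 4"
  shows "small_excess_graph (pverts G) (\<lambda>u v. (u, v) \<in> parcs G) k d"
proof -
  interpret pair_graph G using assms(4) by (simp add: kg_graph_def)
  have G: "pair_graph G" ..
  show ?thesis
  proof
    show "finite (pverts G)" by (rule pair_finite_verts)
    show "u \<in> pverts G" if "(u, v) \<in> parcs G" for u v using that in_arcsD1 by blast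
    show "(v, u) \<in> parcs G" if "(u, v) \<in> parcs G" for u v
      using pair_sym_arcs that by (auto simp: symmetric_def dest: symD)
    show "(v, v) \<notin> parcs G" for v using pair_no_loops[of "(v, v)"] by auto
    show "card {u. (v, u) \<in> parcs G} = k" if "v \<in> pverts G" for v
    proof -
      have "out_arcs (with_proj G) v = Pair v ` {u. (v, u) \<in> parcs G}" by (auto simp: out_arcs_def)
      then have "card (out_arcs (with_proj G) v) = card {u. (v, u) \<in> parcs G}"
        by (simp add: card_image inj_on_def)
      then show ?thesis using that assms(4) by (simp add: kg_graph_def out_degree_def)
    qed
    show "2 * d \<le> length xs" if "3 \<le> length xs" "distinct xs"
      "successively (\<lambda>u v. (u, v) \<in> parcs G) xs" "(last xs, hd xs) \<in> parcs G" for xs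
      using girth_le_cycle[OF G that] assms(2,4) by (simp add: kg_graph_def)
    show "card (pverts G) = moore_bound_even k d + 4" using assms(5) by (simp add: excess_def)
    show "6 \<le> k" "3 \<le> d" using assms by auto
  qed
qed

section \<open>Cycle structure of the excess graph and the spectrum of \<open>A\<close>\<close>

theorem lemma2p5:
  fixes k g d :: nat
    and G :: "'a pair_pre_digraph"
    and vs :: "'a list"
    and A E :: "real mat"
  assumes "k \<ge> 6"
    and "g = 2 * d"
    and "g \<ge> 6"
    and "kg_graph k g G"
    and "excess k d G = 4"
    and "distinct vs"
    and "set vs = pverts G"
    and "A = adjacency_matrix vs G"
    and "E = excess_matrix d vs G"
  shows
    "pair_graph (excess_graph d G) \<and>
     E = adjacency_matrix vs (excess_graph d G) \<and>
     (\<exists>V1 V2. bipartition G V1 V2) \<and>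
     (\<exists>(c::nat) (C :: nat \<Rightarrow> 'a pair_pre_digraph) (l :: nat \<Rightarrow> nat).
        c \<ge> 1 \<and>
        (\<forall>i<c. cycle_graph (l i) (C i)) \<and>
        disjoint_union_of (excess_graph d G) c C \<and>
        (odd d \<longrightarrow>
          (\<forall>V1 V2. bipartition G V1 V2 \<longrightarrow>
            (\<forall>i<c. pverts (C i) \<subseteq> V1 \<or> pverts (C i) \<subseteq> V2))) \<and>
        (odd d \<longrightarrow>
          (\<exists>(S :: real multiset) (y :: nat \<times> nat \<Rightarrow> real).
             size S + 2 = c \<and>
             (\<forall>x \<in># S. poly (H_poly k (d - 1)) x = - 2) \<and>
             (\<forall>(i, j) \<in> (SIGMA i:{..<c}. {1..l i - 1}).
                poly (H_poly k (d - 1)) (y (i, j)) = - 2 * cos (2 * pi * real j / real (l i))) \<and>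
             spectrum_mset A =
               {#real k, - real k#} + S +
               image_mset y (mset_set (SIGMA i:{..<c}. {1..l i - 1})))) \<and>
        (even d \<longrightarrow>
          (\<exists>(S :: real multiset) (p :: nat \<times> nat) (y :: nat \<times> nat \<Rightarrow> real).
             size S + 1 = c \<and>
             (\<forall>x \<in># S. poly (H_poly k (d - 1)) x = - 2) \<and>
             p \<in> (SIGMA i:{..<c}. {1..l i - 1}) \<and>
             (\<forall>(i, j) \<in> (SIGMA i:{..<c}. {1..l i - 1}) - {p}.
                poly (H_poly k (d - 1)) (y (i, j)) = - 2 * cos (2 * pi * real j / real (l i))) \<and>
             spectrum_mset A =
               {#real k, - real k#} + S +
               image_mset y (mset_set ((SIGMA i:{..<c}. {1..l i - 1}) - {p})))))"
proof -
  have G: "pair_graph G" using assms(4) by (simp add: kg_graph_def)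
  interpret small_excess_graph "pverts G" "\<lambda>u v. (u, v) \<in> parcs G" k d
    using kg_graph_imp_small_excess_graph[OF assms(1-5)] .
  define R where "R = {(u, v). u \<in> pverts G \<and> v \<in> pverts G \<and> dst u v = d + 1}"
  note R = antipodal_two_regular[folded R_def]
  have gdist: "gdist G u v = ereal (real (d + 1)) \<longleftrightarrow> dst u v = d + 1"
    if "u \<in> pverts G" "v \<in> pverts G" for u v
  proof -
    have "gdist G u v = ereal (real (dst u v))"
      by (rule gdist_eqI[OF G that(1) dst_walk_V[OF that]]) (rule dst_le_walk)
    then show ?thesis by (simp only: ereal.inject of_nat_eq_iff)
  qed
  have exc: "excess_graph d G = \<lparr>pverts = pverts G, parcs = R\<rparr>"
    unfolding excess_graph_def R_def using gdist by auto
  have 1: "pair_graph (excess_graph d G)"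
  proof -
    have "finite R" using R(1) finite_V finite_subset by blast
    with R(1-3) finite_V show ?thesis unfolding exc
      by unfold_locales (auto simp: symmetric_def irrefl_def)
  qed
  have vs_in: "vs ! i \<in> pverts G" if "i < length vs" for i using that assms(7) nth_mem by blast
  have 2: "E = adjacency_matrix vs (excess_graph d G)"
    unfolding assms(9) excess_matrix_def adjacency_matrix_def excess_graph_def
    by (rule eq_matI) (simp_all add: vs_in)
  obtain w0 where w0: "w0 \<in> pverts G" using V_nonempty by blast
  have 3: "bipartition G {x\<in>pverts G. even (dst w0 x)} {x\<in>pverts G. odd (dst w0 x)}"
  proof -
    have "even (dst w0 u) \<noteq> even (dst w0 v)" if "(u, v) \<in> parcs G" for u v
      using dst_nb[OF that, of w0] dst_nb_ne[OF w0 that] by auto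
    then show ?thesis unfolding bipartition_def using adj_V adj_V2 by auto
  qed
  obtain c C l where C: "\<forall>i<c. cycle_graph (l i) (C i)" "disjoint_union_of (excess_graph d G) c C"
    using two_regular_disjoint_cycles[OF finite_V R] unfolding exc by blast
  have l3: "3 \<le> l i" if "i < c" for i using C(1) that by (auto simp: cycle_graph_def)
  obtain v where v: "bij_betw v (SIGMA i:{..<c}. {..<l i}) (pverts (excess_graph d G))"
    and Cv: "\<And>i. i < c \<Longrightarrow> pverts (C i) = (\<lambda>t. v (i, t)) ` {..<l i}"
    and Rv: "\<And>i s u. i < c \<Longrightarrow> s < l i \<Longrightarrow> (v (i, s), u) \<in> parcs (excess_graph d G) \<longleftrightarrow>
      u = v (i, (s + 1) mod l i) \<or> u = v (i, (s + l i - 1) mod l i)"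
    by (rule disjoint_cycles_param[OF C]) blast
  have c1: "c \<ge> 1"
  proof (rule ccontr)
    assume "\<not> c \<ge> 1"
    then have "c = 0" by simp
    then show False using C(2) V_nonempty by (simp add: disjoint_union_of_def exc)
  qed
  have 4: "pverts (C i) \<subseteq> V1 \<or> pverts (C i) \<subseteq> V2"
    if "odd d" "bipartition G V1 V2" "i < c" for V1 V2 i
  proof -
    \<comment> \<open>Consecutive vertices of a cycle of \<open>G(E)\<close> are joined in
      \<open>G\<close> by a walk of length \<open>d + 1\<close>, which is even for odd
      \<open>d\<close>; so they lie in the same class of any bipartition, and position 0 decides for
      the whole cycle.\<close>
    have step: "v (i, t) \<in> V1 \<longleftrightarrow> v (i, 0) \<in> V1" if "t < l i" for t
      using that
    proof (induction t)
      case (Suc t)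
      then have "(v (i, t), v (i, Suc t)) \<in> R" using Rv[OF \<open>i < c\<close>, of t] by (simp add: exc)
      then have "v (i, t) \<in> pverts G" "v (i, Suc t) \<in> pverts G" "dst (v (i, t)) (v (i, Suc t)) = d + 1"
        by (auto simp: R_def)
      then have "((\<lambda>u v. (u, v) \<in> parcs G) ^^ (d + 1)) (v (i, t)) (v (i, Suc t))"
        using dst_walk_V by metis
      then show ?case using bipartition_walk[OF \<open>bipartition G V1 V2\<close>] \<open>odd d\<close> Suc by fastforce
    qed simp
    have "pverts (C i) \<subseteq> V1 \<union> V2"
      using C(2) that unfolding disjoint_union_of_def bipartition_def exc by auto
    then show ?thesis using step Cv[OF \<open>i < c\<close>] by (cases "v (i, 0) \<in> V1") auto
  qed
  define \<phi> where "\<phi> = (\<lambda>(i, j). - 2 * cos (2 * pi * real j / real (l i)))"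
  let ?P = "SIGMA i:{..<c}. {1..l i - 1}"
  let ?H = "poly (H_poly k (d - 1))"
  have finP: "finite ?P" by simp
  \<comment> \<open>All copies of \<open>-2\<close> among the cycle eigenvalues thus come from the
    indices \<open>j = 0\<close>, which makes their number exactly \<open>c\<close>.\<close>
  have neg2: "\<phi> q \<noteq> - 2" if "q \<in> ?P" for q
  proof -
    obtain i j where "q = (i, j)" "i < c" "0 < j" "j < l i" using \<open>q \<in> ?P\<close> by fastforce
    then show ?thesis using cos_root_ne_1[of j "l i"] by (simp add: \<phi>_def)
  qed
  have Adj: "Adj vs = A" unfolding assms(8) adjacency_matrix_def Adj_def[OF assms(6,7) w0] ..
  obtain T where T: "proots (char_poly A) = {#real k, - real k#} + T"
    "image_mset ?H T + {#- 2, - 2 * \<epsilon>#} = proots (char_poly (- Exc vs))"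
    using spectrum_relation[OF assms(6,7) w0] Adj by auto
  have "char_poly (- Exc vs) = (\<Prod>(i, j)\<in>(SIGMA i:{..<c}. {..<l i}). [:2 * cos (2 * pi * real j / real (l i)), 1:])"
  proof (rule char_poly_neg_cycles[OF l3 assms(6)])
    show "bij_betw v (SIGMA i:{..<c}. {..<l i}) (set vs)" using v assms(7) by (simp add: exc)
    show "Exc vs = mat (length vs) (length vs) (\<lambda>(a, b). if (vs ! a, vs ! b) \<in> R then 1 else 0)"
      unfolding Exc_def[OF assms(6,7) w0] R_def by (rule eq_matI) (simp_all add: vs_in)
  qed (use Rv exc in auto)
  also have "\<dots> = (\<Prod>q\<in>(SIGMA i:{..<c}. {..<l i}). [:- \<phi> q, 1:])"
    by (intro prod.cong) (auto simp: \<phi>_def)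
  finally have "proots (char_poly (- Exc vs)) = image_mset \<phi> (mset_set (SIGMA i:{..<c}. {..<l i}))"
    by (simp add: proots_prod_linear)
  also have "\<dots> = replicate_mset c (- 2) + image_mset \<phi> (mset_set ?P)"
    unfolding \<phi>_def by (rule mset_cycle_eigenvalues[OF l3])
  finally have main: "image_mset ?H T + {#- 2, - 2 * \<epsilon>#} = replicate_mset c (- 2) + image_mset \<phi> (mset_set ?P)"
    using T by simp
  have 5: "\<exists>S y. size S + 2 = c \<and> (\<forall>x \<in># S. ?H x = - 2) \<and>
      (\<forall>(i, j) \<in> ?P. ?H (y (i, j)) = - 2 * cos (2 * pi * real j / real (l i))) \<and>
      spectrum_mset A = {#real k, - real k#} + S + image_mset y (mset_set ?P)" if "odd d"
  proof -
    have "\<epsilon> = 1" using that by (simp add: \<epsilon>_def[OF assms(6,7) w0])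
    \<comment> \<open>For \<open>\<epsilon> = 1\<close> both exchanged eigenvalues of
      \<open>-E\<close> are \<open>-2\<close>. Comparing the multiplicities of \<open>-2\<close> in
      \<open>main\<close> shows \<open>c \<ge> 2\<close> and leaves \<open>c - 2\<close>
      copies.\<close>
    have "count (image_mset \<phi> (mset_set ?P)) (- 2) = 0"
      using neg2 finP by (auto simp: count_eq_zero_iff)
    then have "count (image_mset ?H T) (- 2) + 2 = c"
      using arg_cong[OF main, of "\<lambda>M. count M (- 2)"] \<open>\<epsilon> = 1\<close> by simp
    then obtain m where m: "c = m + 2" by metis
    have "image_mset ?H T = replicate_mset m (- 2) + image_mset \<phi> (mset_set ?P)"
      using main unfolding m \<open>\<epsilon> = 1\<close> by simp
    from image_mset_split[OF finP this] obtain S y where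
      "T = S + image_mset y (mset_set ?P)" "size S = m" "\<forall>x\<in>#S. ?H x = - 2" "\<forall>q\<in>?P. ?H (y q) = \<phi> q"
      by blast
    then show ?thesis using T(1) m unfolding spectrum_mset_def
      by (intro exI[of _ S] exI[of _ y]) (auto simp: \<phi>_def)
  qed
  have 6: "\<exists>S p y. size S + 1 = c \<and> (\<forall>x \<in># S. ?H x = - 2) \<and> p \<in> ?P \<and>
      (\<forall>(i, j) \<in> ?P - {p}. ?H (y (i, j)) = - 2 * cos (2 * pi * real j / real (l i))) \<and>
      spectrum_mset A = {#real k, - real k#} + S + image_mset y (mset_set (?P - {p}))" if "even d"
  proof -
    have \<epsilon>: "\<epsilon> = - 1" using that by (simp add: \<epsilon>_def[OF assms(6,7) w0])
    \<comment> \<open>For \<open>\<epsilon> = -1\<close> the second exchanged eigenvalue is 2. On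
      the right of \<open>main\<close> it can only be some \<open>\<phi> p\<close>, where the cosine
      is \<open>-1\<close>; this \<open>p\<close> is the excepted equation, and the first exchange
      leaves \<open>c - 1\<close> copies of \<open>-2\<close>.\<close>
    have "2 \<in># image_mset ?H T + {#- 2, - 2 * \<epsilon>#}" by (simp add: \<epsilon>)
    then have "2 \<in># image_mset \<phi> (mset_set ?P)" unfolding main by (auto split: if_splits)
    then obtain p where p: "p \<in> ?P" "\<phi> p = 2" using finP by auto
    have "mset_set ?P = add_mset p (mset_set (?P - {p}))"
      using finP p(1) by (metis mset_set.remove)
    moreover obtain m where m: "c = m + 1" using c1 by (metis le_add_diff_inverse2)
    ultimately have "image_mset ?H T = replicate_mset m (- 2) + image_mset \<phi> (mset_set (?P - {p}))"
      using main p(2) unfolding \<epsilon> by simp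
    from image_mset_split[OF _ this] finP obtain S y where
      "T = S + image_mset y (mset_set (?P - {p}))" "size S = m" "\<forall>x\<in>#S. ?H x = - 2"
      and y: "\<forall>q\<in>?P - {p}. ?H (y q) = \<phi> q"
      by blast
    moreover have "\<forall>(i, j) \<in> ?P - {p}. ?H (y (i, j)) = - 2 * cos (2 * pi * real j / real (l i))"
    proof
      fix q assume "q \<in> ?P - {p}"
      with y have "?H (y q) = \<phi> q" by blast
      then show "case q of (i, j) \<Rightarrow> ?H (y (i, j)) = - 2 * cos (2 * pi * real j / real (l i))"
        by (cases q) (simp add: \<phi>_def)
    qed
    moreover have "spectrum_mset A = {#real k, - real k#} + S + image_mset y (mset_set (?P - {p}))"
      unfolding spectrum_mset_def T(1) calculation(1) by (simp only: add.assoc)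
    ultimately show ?thesis using m p(1) by blast
  qed
  show ?thesis
  proof (intro conjI exI[of _ c] exI[of _ C] exI[of _ l] impI allI)
    show "\<exists>V1 V2. bipartition G V1 V2" using 3 by blast
  qed (fact 1 2 c1 C(2) | rule C(1)[rule_format] 4 5 6, assumption+)+
qed

end
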